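(* Let the ILRFPP model on $\mathbb{Z}^d$ satisfy the standing assumptions, and suppose $\alpha>\max\{d/\theta,\,d/\gamma\}$. Then there exist $\eta>0$ and $C<\infty$ such that $$\sup_{u\in\mathbb{Z}^d\setminus\{0\}}\mathbb{P}\big(T(0,u)\le t\big)\le C\,t^{\eta}\qquad\text{for all }t\in[0,1].$$ In particular, for every fixed $x\in\mathbb{R}^d$ with $\|x\|_\infty\le1$, $x\neq0$, the sequence $T_n:=T(0,\lceil nx\rceil)$ satisfies $T_n=\Omega_{\mathbb{P}}(1)$; and if moreover $\alpha<2d/\gamma$ (that is, $\max\{d/\gamma,d/\theta\}<\alpha<2d/\gamma$), then $T_n=\Theta_{\mathbb{P}}(1)$.
   Context: Model (inhomogeneous long-range first-passage percolation, ILRFPP). Fix an integer $d\ge1$ and $\alpha>0$; $\|\cdot\|$ is the $\ell_1$ norm on $\mathbb{Z}^d$. The vertex weights $(V_x)_{x\in\mathbb{Z}^d}$ are i.i.d. with the law of a random variable $V$; the edge noises $\omega_{xy}=\omega_{yx}\ge0$, one for every unordered pair $\{x,y\}$ of distinct vertices of $\mathbb{Z}^d$ (all pairs are edges), are i.i.d. with the law of $\omega$, and independent of the vertex weights. The passage time of an edge is $W_{xy}:=\|x-y\|^{\alpha}\,\omega_{xy}/(V_xV_y)$. A path is a finite sequence of distinct vertices; its passage time is the sum of $W$ over its consecutive edges. $T(x,y)$ is the infimum of the passage times over all finite self-avoiding paths from $x$ to $y$. $\lceil nx\rceil$ is the coordinatewise ceiling. Standing assumptions: for fixed $\gamma,\theta,\zeta>0$,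 $\mathbb{P}(0<V<\infty)=1$ and $\lim_{x\to\infty}\log\mathbb{P}(V\ge x)/\log x=-\gamma$; $\lim_{x\downarrow0}\log\mathbb{P}(\omega\le x)/\log x=\theta$ and $\mathbb{E}\,\omega^{\zeta}<\infty$. Notation: $T_n=\Omega_{\mathbb{P}}(1)$ means that for every $\varepsilon>0$ there is $c>0$ with $\mathbb{P}(T_n\ge c)\ge1-\varepsilon$ for all sufficiently large $n$; $T_n=O_{\mathbb{P}}(1)$ means that for every $\varepsilon>0$ there is $C<\infty$ with $\mathbb{P}(T_n\le C)\ge1-\varepsilon$ for all sufficiently large $n$; $\Theta_{\mathbb{P}}(1)$ means both. *)

theory Defs
  imports "HOL-Probability.Probability"
begin

definition l1_norm :: "int ^ 'd::finite \<Rightarrow> real" where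
  "l1_norm x = (\<Sum>i\<in>UNIV. \<bar>real_of_int (x $ i)\<bar>)"

definition ceiling_vec :: "real ^ 'd::finite \<Rightarrow> int ^ 'd" where
  "ceiling_vec x = (\<chi> i. \<lceil>x $ i\<rceil>)"

text \<open>An unordered pair of distinct vertices is represented as a two-element set.\<close>

definition edges :: "(int ^ 'd::finite) set set" where
  "edges = {e. card e = 2}"

text \<open>Vertex weights \<open>V\<close> and edge noises \<open>N\<close> (written \<open>\<omega>\<close> in the model description) are
  functions of the sample point \<open>w\<close>. Passage times are taken in \<^typ>\<open>ennreal\<close>, so that infima
  exist at every sample point; the coercion is only lossy on the null event where some
  vertex weight fails to be positive or some noise is negative.\<close>

definition edge_time ::
  "real \<Rightarrow> (int ^ 'd::finite \<Rightarrow> 'a \<Rightarrow> real) \<Rightarrow> ((int ^ 'd) set \<Rightarrow> 'a \<Rightarrow> real)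
    \<Rightarrow> 'a \<Rightarrow> int ^ 'd \<Rightarrow> int ^ 'd \<Rightarrow> ennreal" where
  "edge_time \<alpha> V N w x y =
     ennreal (l1_norm (x - y) powr \<alpha> * N {x, y} w / (V x w * V y w))"

definition path_time :: "('v \<Rightarrow> 'v \<Rightarrow> ennreal) \<Rightarrow> 'v list \<Rightarrow> ennreal" where
  "path_time W p = (\<Sum>i<length p - 1. W (p ! i) (p ! Suc i))"

definition paths :: "'v \<Rightarrow> 'v \<Rightarrow> 'v list set" where
  "paths x y = {p. p \<noteq> [] \<and> distinct p \<and> hd p = x \<and> last p = y}"

definition passage_time ::
  "real \<Rightarrow> (int ^ 'd::finite \<Rightarrow> 'a \<Rightarrow> real) \<Rightarrow> ((int ^ 'd) set \<Rightarrow> 'a \<Rightarrow> real)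
    \<Rightarrow> int ^ 'd \<Rightarrow> int ^ 'd \<Rightarrow> 'a \<Rightarrow> ennreal" where
  "passage_time \<alpha> V N x y w = (INF p\<in>paths x y. path_time (edge_time \<alpha> V N w) p)"

text \<open>\<open>\<nu>\<close> is the common law of the vertex weights and \<open>\<mu>\<close> that of the edge noises. Indexing
  by a sum type expresses in one condition that the weights are independent, the noises are
  independent, and the two families are independent of each other.\<close>

locale ilrfpp = prob_space M
  for M :: "'a measure"
    and \<alpha> :: real
    and \<nu> \<mu> :: "real measure"
    and V :: "int ^ 'd::finite \<Rightarrow> 'a \<Rightarrow> real"
    and N :: "(int ^ 'd) set \<Rightarrow> 'a \<Rightarrow> real" +
  assumes alpha_pos: "\<alpha> > 0"
    and indep: "indep_vars (\<lambda>_. borel) (case_sum V N) (UNIV <+> edges)"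
    and law_V: "\<And>x. distr M borel (V x) = \<nu>"
    and law_N: "\<And>e. e \<in> edges \<Longrightarrow> distr M borel (N e) = \<mu>"
    and N_nonneg: "AE r in \<mu>. 0 \<le> r"

text \<open>Since \<open>ln 0 = 0\<close> in HOL, a tail probability that vanishes eventually would make the
  corresponding quotient tend to \<open>0\<close>; this is excluded by \<open>\<gamma> > 0\<close> and \<open>\<theta> > 0\<close>, just as the
  convention \<open>log 0 = -\<infinity>\<close> excludes it.\<close>

definition standing_assumptions ::
  "real measure \<Rightarrow> real measure \<Rightarrow> real \<Rightarrow> real \<Rightarrow> real \<Rightarrow> bool" where
  "standing_assumptions \<nu> \<mu> \<gamma> \<theta> \<zeta> \<longleftrightarrow>
     \<gamma> > 0 \<and> \<theta> > 0 \<and> \<zeta> > 0 \<and>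
     (AE v in \<nu>. 0 < v) \<and>
     ((\<lambda>x. ln (measure \<nu> {x..}) / ln x) \<longlongrightarrow> - \<gamma>) at_top \<and>
     ((\<lambda>x. ln (measure \<mu> {..x}) / ln x) \<longlongrightarrow> \<theta>) (at_right 0) \<and>
     integrable \<mu> (\<lambda>r. r powr \<zeta>)"

definition Omega_P1 :: "'a measure \<Rightarrow> (nat \<Rightarrow> 'a \<Rightarrow> ennreal) \<Rightarrow> bool" where
  "Omega_P1 M X \<longleftrightarrow> (\<forall>\<epsilon>>0. \<exists>c::real. c > 0 \<and>
     (\<forall>\<^sub>F n in sequentially. \<P>(w in M. X n w \<ge> ennreal c) \<ge> 1 - \<epsilon>))"

definition O_P1 :: "'a measure \<Rightarrow> (nat \<Rightarrow> 'a \<Rightarrow> ennreal) \<Rightarrow> bool" where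
  "O_P1 M X \<longleftrightarrow> (\<forall>\<epsilon>>0. \<exists>C::real.
     (\<forall>\<^sub>F n in sequentially. \<P>(w in M. X n w \<le> ennreal C) \<ge> 1 - \<epsilon>))"

definition Theta_P1 :: "'a measure \<Rightarrow> (nat \<Rightarrow> 'a \<Rightarrow> ennreal) \<Rightarrow> bool" where
  "Theta_P1 M X \<longleftrightarrow> Omega_P1 M X \<and> O_P1 M X"

text \<open>Passage times are random variables, so the probabilities of the events below are
  genuine ones (\<^const>\<open>measure\<close> is \<open>0\<close> on non-measurable sets).\<close>

lemma (in ilrfpp) measurable_V: "V x \<in> borel_measurable M"
  using indep unfolding indep_vars_def by (auto dest!: bspec[where x = "Inl x"])

lemma (in ilrfpp) measurable_N: "e \<in> edges \<Longrightarrow> N e \<in> borel_measurable M"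
  using indep unfolding indep_vars_def by (auto dest!: bspec[where x = "Inr e"])

lemma countable_UNIV_int_vec: "countable (UNIV :: (int ^ 'd::finite) set)"
proof -
  have "countable (Pi\<^sub>E (UNIV :: 'd set) (\<lambda>_. UNIV :: int set))"
    by (intro countable_PiE) auto
  then have "countable (range (vec_lambda :: ('d \<Rightarrow> int) \<Rightarrow> int ^ 'd))"
    by (simp add: PiE_UNIV_domain)
  moreover have "range (vec_lambda :: ('d \<Rightarrow> int) \<Rightarrow> int ^ 'd) = UNIV"
    by (metis surjI vec_lambda_eta)
  ultimately show ?thesis by simp
qed

lemma (in ilrfpp) measurable_passage_time:
  "passage_time \<alpha> V N x y \<in> borel_measurable M"
proof -
  have c: "countable (paths x y :: (int ^ 'd) list set)"
    using countable_lists[OF countable_UNIV_int_vec] by (auto intro: countable_subset[rotated])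
  have e: "(\<lambda>w. edge_time \<alpha> V N w a b) \<in> borel_measurable M" if "a \<noteq> b" for a b
  proof -
    have "N {a, b} \<in> borel_measurable M"
      using that by (intro measurable_N) (simp add: edges_def)
    with measurable_V[of a] measurable_V[of b] show ?thesis
      unfolding edge_time_def by measurable
  qed
  have "(\<lambda>w. path_time (edge_time \<alpha> V N w) p) \<in> borel_measurable M" if "p \<in> paths x y" for p
    unfolding path_time_def using that
    by (intro borel_measurable_sum e) (auto simp: paths_def nth_eq_iff_index_eq)
  then show ?thesis
    using c unfolding passage_time_def by (intro borel_measurable_INF) auto
qed

end

theory Submission imports Defs begin

text \<open>
  \<^bold>\<open>Lower bound.\<close> A path from \<open>0\<close> to \<open>u \<noteq> 0\<close> has to leave \<open>0\<close>, so its passage time is at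
  least that of its first edge, and it suffices to see that no edge at \<open>0\<close> is fast. Since
  \<open>\<alpha> > d / \<theta>\<close> and \<open>\<alpha> > d / \<gamma>\<close>, there is an exponent \<open>\<kappa>\<close> with \<open>d / \<alpha> < \<kappa> < min \<theta> \<gamma>\<close>.
  Below \<open>\<gamma>\<close> the moment \<open>E V\<^sup>\<kappa>\<close> is finite, below \<open>\<theta>\<close> the moment \<open>E \<omega>\<^sup>-\<^sup>\<kappa>\<close> is finite
  (\<open>moment_finite_of_tail\<close>), and \<open>\<alpha>\<kappa> > d\<close> makes the sum of \<open>\<parallel>y\<parallel>\<^sup>-\<^sup>\<alpha>\<^sup>\<kappa>\<close> over \<open>y \<noteq> 0\<close> converge
  (\<open>lattice_sum_finite\<close>). By independence the sum of \<open>W\<^sub>0\<^sub>y\<^sup>-\<^sup>\<kappa>\<close> over \<open>y\<close> has finite expectation,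
  and Markov's inequality for this sum gives the bound \<open>C t\<^sup>\<kappa>\<close>, uniformly in \<open>u\<close>
  (\<open>passage_time_small_prob\<close>).

  \<^bold>\<open>Upper bound.\<close> If \<open>\<alpha> < 2d / \<gamma>\<close>, choose \<open>\<rho>\<close> with \<open>\<alpha> / 2 < \<rho> < d / \<gamma>\<close>. A cube of side
  \<open>2\<^sup>k\<close> contains, except with a probability summable in \<open>k\<close>, a vertex of weight at least
  \<open>2\<^sup>k\<^sup>\<rho>\<close>, because \<open>\<rho>\<gamma> < d\<close> (\<open>sparse_summable\<close>). An edge between two such vertices at distance
  of order \<open>2\<^sup>k\<close> costs of order \<open>2\<^sup>-\<^sup>2\<^sup>k\<^sup>\<tau> \<omega>\<close> with \<open>2\<tau> = 2\<rho> - \<alpha> > 0\<close>, and \<open>\<omega> \<le> 2\<^sup>k\<^sup>\<tau>\<close>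
  except with a probability that the finite moment of \<open>\<omega>\<close> makes summable. Climbing
  through such vertices in growing cubes around \<open>0\<close>, crossing at a scale no smaller than
  \<open>\<parallel>u\<parallel>\<close>, and descending through growing cubes around
  \<open>u\<close> therefore costs a convergent geometric series plus the two first edges, which live at
  one fixed scale (\<open>chain_cost\<close>, \<open>passage_time_tight\<close>). Two points keep the argument short.
  The visited vertices are selected by looking at the weights only, so the noise on the edge
  between two of them still has law \<open>\<mu>\<close> (\<open>selected_noise\<close>). And the resulting walk need not be
  self-avoiding, since erasing its loops only lowers the cost, which makes the passage time a
  pseudometric (\<open>passage_time_triangle\<close>).
\<close>

section \<open>Walks and the triangle inequality\<close>

lemma path_time_Cons:
  "path_time W (x # y # p) = W x y + path_time W (y # p)"
  unfolding path_time_def by (simp add: sum.lessThan_Suc_shift del: sum.lessThan_Suc)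

lemma path_time_append:
  "path_time W (p @ x # q) = path_time W (p @ [x]) + path_time W (x # q)"
proof (induction p)
  case Nil
  then show ?case by (simp add: path_time_def)
next
  case (Cons a p)
  then show ?case by (cases p) (auto simp: path_time_Cons add.assoc)
qed

text \<open>Cutting out the stretch between two visits of the same vertex shortens the walk, keeps its
  endpoints and drops nonnegative terms from its cost; iterate until no vertex repeats.\<close>

lemma loop_erasure:
  assumes "p \<noteq> []"
  shows "\<exists>q\<in>paths (hd p) (last p). path_time W q \<le> path_time W p"
  using assms
proof (induction p rule: length_induct)
  case (1 p)
  show ?case
  proof (cases "distinct p")
    case True
    with 1 show ?thesis by (auto simp: paths_def)
  next
    case False
    then obtain xs ys zs y where p: "p = xs @ [y] @ ys @ [y] @ zs"
      using not_distinct_decomp by blast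
    let ?q = "xs @ y # zs"
    have hl: "hd ?q = hd p" "last ?q = last p"
      by (auto simp: p hd_append)
    have "\<exists>q\<in>paths (hd ?q) (last ?q). path_time W q \<le> path_time W ?q"
      using 1(1)[rule_format, of ?q] by (simp add: p)
    moreover have "path_time W ?q \<le> path_time W p"
    proof -
      have "path_time W p = path_time W (xs @ [y]) + path_time W ((y # ys) @ y # zs)"
        using path_time_append[of W xs y "ys @ y # zs"] by (simp add: p)
      also have "path_time W ((y # ys) @ y # zs) = path_time W ((y # ys) @ [y]) + path_time W (y # zs)"
        by (rule path_time_append)
      finally have "path_time W p = path_time W ?q + path_time W ((y # ys) @ [y])"
        using path_time_append[of W xs y zs] by (simp add: ac_simps)
      then show ?thesis by simp
    qed
    ultimately show ?thesis unfolding hl by (meson order_trans)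
  qed
qed

lemma passage_time_le_walk:
  assumes "p \<noteq> []" "hd p = x" "last p = y"
  shows "passage_time \<alpha> V N x y w \<le> path_time (edge_time \<alpha> V N w) p"
proof -
  obtain q where "q \<in> paths x y" "path_time (edge_time \<alpha> V N w) q \<le> path_time (edge_time \<alpha> V N w) p"
    using loop_erasure[OF assms(1), of "edge_time \<alpha> V N w"] assms(2,3) by auto
  then show ?thesis unfolding passage_time_def by (rule INF_lower2)
qed

lemma passage_time_le_edge: "passage_time \<alpha> V N x y w \<le> edge_time \<alpha> V N w x y"
  using passage_time_le_walk[of "[x, y]" x y \<alpha> V N w] by (simp add: path_time_def)

lemma INF_add_ennreal:
  fixes f :: "'i \<Rightarrow> ennreal"
  assumes "I \<noteq> {}"
  shows "(INF i\<in>I. f i + c) = (INF i\<in>I. f i) + c"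
proof -
  have "continuous (at_right (Inf (f ` I))) (\<lambda>x. x + c)"
    by (intro continuous_add) auto
  with assms have "Inf (f ` I) + c = (INF x\<in>f ` I. x + c)"
    by (intro continuous_at_Inf_mono) (auto simp: mono_def)
  then show ?thesis by (simp add: image_comp comp_def)
qed

text \<open>Concatenating two self-avoiding paths gives a walk that may revisit vertices, to which loop
  erasure applies.\<close>

lemma passage_time_triangle:
  fixes V :: "int ^ 'd::finite \<Rightarrow> 'a \<Rightarrow> real"
  shows "passage_time \<alpha> V N x z w \<le> passage_time \<alpha> V N x y w + passage_time \<alpha> V N y z w"
proof -
  have "passage_time \<alpha> V N x z w \<le> path_time (edge_time \<alpha> V N w) p + path_time (edge_time \<alpha> V N w) q"
    if p: "p \<in> paths x y" and q: "q \<in> paths y z" for p q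
  proof -
    from p obtain p' where p': "p = p' @ [y]"
      by (auto simp: paths_def intro: append_butlast_last_id[symmetric])
    from q obtain q' where q': "q = y # q'"
      by (cases q) (auto simp: paths_def)
    have "passage_time \<alpha> V N x z w \<le> path_time (edge_time \<alpha> V N w) (p' @ y # q')"
      using p q by (intro passage_time_le_walk) (auto simp: paths_def p' q' hd_append)
    then show ?thesis
      using path_time_append[of "edge_time \<alpha> V N w" p' y q'] by (simp add: p' q')
  qed
  note walk = this
  let ?W = "path_time (edge_time \<alpha> V N w)" and ?T = "\<lambda>x y. passage_time \<alpha> V N x y w"
  have ne: "paths x y \<noteq> {}" for x y :: "int ^ 'd"
    using loop_erasure[of "[x, y]" "\<lambda>_ _. 0"] by auto
  have "?T x z \<le> ?W p + ?T y z" if p: "p \<in> paths x y" for p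
  proof -
    have "?T x z \<le> (INF q\<in>paths y z. ?W q + ?W p)"
      using walk[OF p] by (intro INF_greatest) (simp add: add.commute)
    also have "\<dots> = ?T y z + ?W p"
      unfolding passage_time_def by (rule INF_add_ennreal[OF ne])
    finally show ?thesis by (simp add: add.commute)
  qed
  then have "?T x z \<le> (INF p\<in>paths x y. ?W p + ?T y z)"
    by (intro INF_greatest)
  also have "\<dots> = ?T x y + ?T y z"
    unfolding passage_time_def[of _ _ _ x y] by (rule INF_add_ennreal[OF ne])
  finally show ?thesis .
qed

lemma l1_norm_minus_commute: "l1_norm (x - y) = l1_norm (y - x)"
  unfolding l1_norm_def by (simp add: abs_minus_commute)

lemma edge_time_commute: "edge_time \<alpha> V N w x y = edge_time \<alpha> V N w y x"
  unfolding edge_time_def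
  by (simp add: l1_norm_minus_commute insert_commute mult.commute)

lemma passage_time_chain:
  assumes "m \<le> n"
  shows "passage_time \<alpha> V N (f m) (f n) w \<le> (\<Sum>k\<in>{m..<n}. edge_time \<alpha> V N w (f k) (f (Suc k)))"
    and "passage_time \<alpha> V N (f n) (f m) w \<le> (\<Sum>k\<in>{m..<n}. edge_time \<alpha> V N w (f k) (f (Suc k)))"
proof -
  have self: "passage_time \<alpha> V N x x w = 0" for x
    using passage_time_le_walk[of "[x]" x x \<alpha> V N w] by (simp add: path_time_def)
  show "passage_time \<alpha> V N (f m) (f n) w \<le> (\<Sum>k\<in>{m..<n}. edge_time \<alpha> V N w (f k) (f (Suc k)))"
    using assms
  proof (induction n rule: dec_induct)
    case (step n)
    have "passage_time \<alpha> V N (f m) (f (Suc n)) w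
        \<le> passage_time \<alpha> V N (f m) (f n) w + edge_time \<alpha> V N w (f n) (f (Suc n))"
      by (meson passage_time_triangle passage_time_le_edge add_left_mono order_trans)
    with step show ?case by (auto intro: order_trans add_right_mono)
  qed (simp add: self)
  show "passage_time \<alpha> V N (f n) (f m) w \<le> (\<Sum>k\<in>{m..<n}. edge_time \<alpha> V N w (f k) (f (Suc k)))"
    using assms
  proof (induction n rule: dec_induct)
    case (step n)
    have "passage_time \<alpha> V N (f (Suc n)) (f m) w
        \<le> edge_time \<alpha> V N w (f n) (f (Suc n)) + passage_time \<alpha> V N (f n) (f m) w"
      by (subst edge_time_commute) (meson passage_time_triangle passage_time_le_edge add_right_mono order_trans)
    with step show ?case by (auto simp: add.commute intro: order_trans add_left_mono)
  qed (simp add: self)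
qed

section \<open>Geometry of the lattice\<close>

lemma card_vec_box:
  assumes "\<And>i. finite (S i)"
  shows "finite {x :: 'b ^ 'd::finite. \<forall>i. x $ i \<in> S i}"
    and "card {x :: 'b ^ 'd::finite. \<forall>i. x $ i \<in> S i} = (\<Prod>i\<in>UNIV. card (S i))"
proof -
  have "bij_betw vec_nth {x :: 'b ^ 'd::finite. \<forall>i. x $ i \<in> S i} (Pi\<^sub>E UNIV S)"
    by (rule bij_betwI[where g = vec_lambda]) auto
  then show "finite {x :: 'b ^ 'd::finite. \<forall>i. x $ i \<in> S i}"
    and "card {x :: 'b ^ 'd::finite. \<forall>i. x $ i \<in> S i} = (\<Prod>i\<in>UNIV. card (S i))"
    using assms by (auto simp: bij_betw_finite bij_betw_same_card card_PiE finite_PiE)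
qed

lemma l1_norm_nonneg: "0 \<le> l1_norm x"
  unfolding l1_norm_def by (simp add: sum_nonneg)

lemma l1_norm_ge_1: "x \<noteq> 0 \<Longrightarrow> 1 \<le> l1_norm x"
proof -
  assume "x \<noteq> 0"
  then obtain i where "x $ i \<noteq> 0" by (auto simp: vec_eq_iff)
  then have "1 \<le> \<bar>real_of_int (x $ i)\<bar>" by linarith
  also have "\<dots> \<le> l1_norm x" unfolding l1_norm_def by (rule member_le_sum) auto
  finally show ?thesis .
qed

lemma abs_nth_le_l1_norm: "\<bar>real_of_int (x $ i)\<bar> \<le> l1_norm x"
  unfolding l1_norm_def by (rule member_le_sum) auto

lemma l1_norm_triangle: "l1_norm (x + y) \<le> l1_norm x + l1_norm y"
  unfolding l1_norm_def sum.distrib[symmetric] by (intro sum_mono) auto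

lemma ennreal_suminf_geometric_finite:
  fixes c r :: real
  assumes "0 \<le> c" "0 \<le> r" "r < 1"
  shows "(\<Sum>k. ennreal (c * r ^ k)) < \<infinity>"
proof -
  have "summable (\<lambda>k. c * r ^ k)" using assms by (auto intro!: summable_mult summable_geometric)
  then show ?thesis using assms by (subst suminf_ennreal2) auto
qed

lemma le_suminf_ennreal: "f k \<le> (\<Sum>k. f k :: ennreal)"
  using sum_le_suminf[of f "{k}"] by simp

lemma dyadic_scale:
  fixes r :: real
  assumes "1 \<le> r"
  obtains k :: nat where "2 ^ k \<le> r" "r < 2 ^ Suc k"
proof -
  define k where "k = (LEAST k. r < 2 ^ Suc k)"
  obtain j where "r < 2 ^ j" using real_arch_pow[of 2 r] by auto
  also have "2 ^ j \<le> (2 :: real) ^ Suc j" by simp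
  finally have ex: "\<exists>k. r < 2 ^ Suc k" by blast
  have "r < 2 ^ Suc k" unfolding k_def using ex by (rule LeastI_ex)
  moreover have "2 ^ k \<le> r"
  proof (cases k)
    case 0 with assms show ?thesis by simp
  next
    case (Suc j)
    then have "\<not> r < 2 ^ Suc j" unfolding k_def by (intro not_less_Least) (simp add: k_def[symmetric])
    with Suc show ?thesis by simp
  qed
  ultimately show ?thesis using that by blast
qed

lemma two_powr_nat: "(2 ^ k) powr a = (2 powr a :: real) ^ k"
proof -
  have "(2 ^ k :: real) powr a = (2 powr real k) powr a" by (simp add: powr_realpow)
  also have "\<dots> = (2 powr a) powr real k" by (simp add: powr_powr mult.commute)
  finally show ?thesis by (simp add: powr_realpow)
qed

text \<open>The dyadic shell at distance about \<open>2\<^sup>k\<close> has at most \<open>(4 \<cdot> 2\<^sup>k)\<^sup>d\<close> points, each contributing at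
  most \<open>2\<^sup>-\<^sup>k\<^sup>s\<close>; for \<open>s > d\<close> this is a convergent geometric series.\<close>

lemma lattice_sum_finite:
  assumes "real CARD('d::finite) < s"
  shows "(\<integral>\<^sup>+y. ennreal (l1_norm y powr - s) \<partial>count_space (UNIV - {0 :: int ^ 'd})) < \<infinity>"
proof -
  let ?d = "CARD('d)"
  let ?B = "\<lambda>k. {y :: int ^ 'd. l1_norm y < 2 ^ Suc k}"
  have sub: "?B k \<subseteq> {y. \<forall>i. y $ i \<in> {- (2 ^ Suc k)..<2 ^ Suc k}}" for k
  proof safe
    fix y :: "int ^ 'd" and i assume "l1_norm y < 2 ^ Suc k"
    with abs_nth_le_l1_norm[of y i] have "\<bar>real_of_int (y $ i)\<bar> < real_of_int (2 ^ Suc k)" by simp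
    then show "y $ i \<in> {- (2 ^ Suc k)..<2 ^ Suc k}" by (simp only: of_int_abs[symmetric] of_int_less_iff) auto
  qed
  have fin: "finite (?B k)" for k
    by (rule finite_subset[OF sub card_vec_box(1)]) auto
  have cardB: "real (card (?B k)) \<le> (4 ^ ?d) * (2 ^ ?d) ^ k" for k
  proof -
    have "card (?B k) \<le> card {y :: int ^ 'd. \<forall>i. y $ i \<in> {- (2 ^ Suc k)..<2 ^ Suc k}}"
      by (rule card_mono[OF card_vec_box(1) sub]) auto
    also have "\<dots> = (4 * 2 ^ k) ^ ?d"
      by (subst card_vec_box(2)) (auto simp: nat_mult_distrib nat_power_eq)
    finally have "real (card (?B k)) \<le> real ((4 * 2 ^ k) ^ ?d)" by (simp only: of_nat_le_iff)
    also have "\<dots> = (4 ^ ?d) * (2 ^ ?d) ^ k" by (simp add: power_mult_distrib power_mult[symmetric] mult.commute)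
    finally show ?thesis .
  qed
  have "(\<integral>\<^sup>+y. ennreal (l1_norm y powr - s) \<partial>count_space (UNIV - {0 :: int ^ 'd}))
     \<le> (\<integral>\<^sup>+y. (\<Sum>k. ennreal ((2 powr - s) ^ k) * indicator (?B k) y) \<partial>count_space (UNIV - {0 :: int ^ 'd}))"
  proof (rule nn_integral_mono)
    fix y :: "int ^ 'd" assume "y \<in> space (count_space (UNIV - {0}))"
    then have "1 \<le> l1_norm y" by (auto intro: l1_norm_ge_1)
    then obtain k where k: "2 ^ k \<le> l1_norm y" "l1_norm y < 2 ^ Suc k" by (rule dyadic_scale)
    have "l1_norm y powr - s \<le> (2 ^ k) powr - s"
      using k assms by (intro powr_mono2') auto
    then have "ennreal (l1_norm y powr - s) \<le> ennreal ((2 powr - s) ^ k) * indicator (?B k) y"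
      using k by (simp add: two_powr_nat ennreal_leI)
    also have "\<dots> \<le> (\<Sum>k. ennreal ((2 powr - s) ^ k) * indicator (?B k) y)"
      by (rule le_suminf_ennreal)
    finally show "ennreal (l1_norm y powr - s) \<le> (\<Sum>k. ennreal ((2 powr - s) ^ k) * indicator (?B k) y)" .
  qed
  also have "\<dots> = (\<Sum>k. \<integral>\<^sup>+y. ennreal ((2 powr - s) ^ k) * indicator (?B k) y \<partial>count_space (UNIV - {0 :: int ^ 'd}))"
    by (rule nn_integral_suminf) auto
  also have "\<dots> \<le> (\<Sum>k. ennreal (4 ^ ?d * (2 powr (?d - s)) ^ k))"
  proof (intro suminf_le)
    fix k
    have "(\<integral>\<^sup>+y. ennreal ((2 powr - s) ^ k) * indicator (?B k) y \<partial>count_space (UNIV - {0 :: int ^ 'd}))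
       \<le> (\<integral>\<^sup>+y. ennreal ((2 powr - s) ^ k) * indicator (?B k) y \<partial>count_space UNIV)"
      by (simp add: nn_integral_count_space_indicator nn_integral_mono split: split_indicator)
    also have "\<dots> = ennreal ((2 powr - s) ^ k) * ennreal (real (card (?B k)))"
      using fin by (subst nn_integral_cmult_indicator) (auto simp: ennreal_of_nat_eq_real_of_nat)
    also have "\<dots> \<le> ennreal ((2 powr - s) ^ k) * ennreal ((4 ^ ?d) * (2 ^ ?d) ^ k)"
      using cardB by (intro mult_left_mono ennreal_leI) auto
    also have "\<dots> = ennreal (4 ^ ?d * (2 powr (?d - s)) ^ k)"
      by (subst ennreal_mult[symmetric])
         (auto simp: powr_diff powr_minus powr_realpow field_simps power_divide)
    finally show "(\<integral>\<^sup>+y. ennreal ((2 powr - s) ^ k) * indicator (?B k) y \<partial>count_space (UNIV - {0 :: int ^ 'd}))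
        \<le> ennreal (4 ^ ?d * (2 powr (?d - s)) ^ k)" .
  qed auto
  also have "\<dots> < \<infinity>"
    using assms by (intro ennreal_suminf_geometric_finite) (auto simp: powr_less_one)
  finally show ?thesis .
qed

definition cube :: "int ^ 'd::finite \<Rightarrow> nat \<Rightarrow> (int ^ 'd) set" where
  "cube z k = {x. \<forall>i. x $ i \<in> {z $ i..<z $ i + 2 ^ k}}"

lemma finite_cube: "finite (cube z k)"
  unfolding cube_def by (rule card_vec_box(1)) auto

lemma card_cube: "card (cube (z :: int ^ 'd::finite) k) = (2 ^ k) ^ CARD('d)"
  unfolding cube_def by (subst card_vec_box(2)) (auto simp: nat_power_eq)

lemma cube_mono: "k \<le> l \<Longrightarrow> cube z k \<subseteq> cube z l"
proof -
  assume "k \<le> l"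
  then have "(2 :: int) ^ k \<le> 2 ^ l" by (intro power_increasing) auto
  then have "t < c + 2 ^ l" if "t < c + 2 ^ k" for t c :: int using that by linarith
  then show ?thesis unfolding cube_def by auto
qed

lemma base_in_cube: "z \<in> cube z k"
  unfolding cube_def by simp

lemma l1_norm_diff_cube:
  fixes x y z :: "int ^ 'd::finite"
  assumes "x \<in> cube z k" "y \<in> cube z k"
  shows "l1_norm (x - y) \<le> real CARD('d) * 2 ^ k"
proof -
  have "\<bar>real_of_int ((x - y) $ i)\<bar> \<le> 2 ^ k" for i
  proof -
    have "\<bar>(x - y) $ i\<bar> \<le> 2 ^ k" using assms unfolding cube_def by (auto dest!: spec[of _ i])
    then have "real_of_int \<bar>(x - y) $ i\<bar> \<le> real_of_int (2 ^ k)" by (simp only: of_int_le_iff)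
    then show ?thesis by simp
  qed
  then show ?thesis unfolding l1_norm_def using sum_bounded_above[of UNIV "\<lambda>i. \<bar>real_of_int ((x - y) $ i)\<bar>" "2 ^ k"]
    by simp
qed

lemma l1_norm_cross_cube:
  fixes x y z z' :: "int ^ 'd::finite"
  assumes x: "x \<in> cube z k" and y: "y \<in> cube z' k" and zz: "l1_norm (z - z') \<le> 2 ^ k"
  shows "l1_norm (x - y) \<le> 2 * real CARD('d) * 2 ^ k"
proof -
  have "y + (z - z') \<in> cube z k"
    using y unfolding cube_def by (auto simp: algebra_simps dest: spec)
  with x have 1: "l1_norm (x - (y + (z - z'))) \<le> real CARD('d) * 2 ^ k" by (rule l1_norm_diff_cube)
  have "1 * 2 ^ k \<le> real CARD('d) * 2 ^ k" by (intro mult_right_mono) (simp_all add: Suc_le_eq)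
  with zz have 2: "l1_norm (z - z') \<le> real CARD('d) * 2 ^ k" by linarith
  have "l1_norm (x - y) \<le> l1_norm (x - (y + (z - z'))) + l1_norm (z - z')"
    using l1_norm_triangle[of "x - (y + (z - z'))" "z - z'"] by simp
  with 1 2 show ?thesis by simp
qed

section \<open>Logarithmic tail exponents and moments\<close>

text \<open>Where \<open>f\<close> vanishes the bound is trivial, so the convention \<open>ln 0 = 0\<close> does no harm.\<close>

lemma log_tail_upper:
  fixes f :: "real \<Rightarrow> real"
  assumes lim: "((\<lambda>x. ln (f x) / ln x) \<longlongrightarrow> - g) at_top" and nonneg: "\<And>x. 0 \<le> f x" and "g' < g"
  shows "\<forall>\<^sub>F x in at_top. f x \<le> x powr - g'"
proof -
  have "\<forall>\<^sub>F x in at_top. ln (f x) / ln x < - g'"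
    using order_tendstoD(2)[OF lim, of "- g'"] \<open>g' < g\<close> by simp
  then show ?thesis
    using eventually_gt_at_top[of 1]
  proof eventually_elim
    case (elim x)
    show ?case
    proof (cases "f x = 0")
      case False
      with nonneg[of x] have "0 < f x" by simp
      moreover from elim have "ln (f x) \<le> - g' * ln x" by (simp add: divide_less_eq)
      ultimately have "f x \<le> exp (- g' * ln x)" by (metis exp_le_cancel_iff exp_ln)
      with elim show ?thesis by (simp add: powr_def)
    qed simp
  qed
qed

text \<open>Here the convention \<open>ln 0 = 0\<close> matters: the limit being strictly negative is what excludes
  zeros of \<open>f\<close> far out.\<close>

lemma log_tail_lower:
  fixes f :: "real \<Rightarrow> real"
  assumes lim: "((\<lambda>x. ln (f x) / ln x) \<longlongrightarrow> - g) at_top" and nonneg: "\<And>x. 0 \<le> f x"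
    and "0 < g" "g < g'"
  shows "\<forall>\<^sub>F x in at_top. x powr - g' \<le> f x"
proof -
  have "\<forall>\<^sub>F x in at_top. ln (f x) / ln x > - g'"
    using order_tendstoD(1)[OF lim, of "- g'"] \<open>g < g'\<close> by simp
  moreover have "\<forall>\<^sub>F x in at_top. ln (f x) / ln x < 0"
    using order_tendstoD(2)[OF lim, of 0] \<open>0 < g\<close> by simp
  ultimately show ?thesis
    using eventually_gt_at_top[of 1]
  proof eventually_elim
    case (elim x)
    then have "f x \<noteq> 0" by auto
    with nonneg[of x] have "0 < f x" by simp
    moreover from elim have "- g' * ln x \<le> ln (f x)" by (simp add: less_divide_eq)
    ultimately have "exp (- g' * ln x) \<le> f x" by (metis exp_le_cancel_iff exp_ln)
    with elim show ?case by (simp add: powr_def)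
  qed
qed

text \<open>The behaviour of the noise near \<open>0\<close> is that of its reciprocal near infinity; this lets one
  moment lemma serve both the weights and the reciprocal noises.\<close>

lemma log_tail_inverse:
  fixes F :: "real \<Rightarrow> real"
  assumes "((\<lambda>x. ln (F x) / ln x) \<longlongrightarrow> g) (at_right 0)"
  shows "((\<lambda>x. ln (F (inverse x)) / ln x) \<longlongrightarrow> - g) at_top"
proof -
  have "((\<lambda>x. - (ln (F (inverse x)) / ln (inverse x))) \<longlongrightarrow> - g) at_top"
    by (intro tendsto_minus filterlim_compose[OF assms] filterlim_inverse_at_right_top)
  moreover have "\<forall>\<^sub>F x in at_top. - (ln (F (inverse x)) / ln (inverse x)) = ln (F (inverse x)) / ln x"
    using eventually_gt_at_top[of 0] by eventually_elim (simp add: ln_inverse)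
  ultimately show ?thesis by (rule Lim_transform_eventually)
qed

lemma filterlim_real_power_at_top:
  fixes r :: real
  assumes "1 < r"
  shows "filterlim (\<lambda>k. r ^ k) at_top sequentially"
  using assms
  by (intro filterlim_at_infinity_imp_filterlim_at_top filterlim_realpow_sequentially_gt1) auto

text \<open>A dyadic layer-cake bound: where \<open>2\<^sup>k \<le> X < 2\<^sup>k\<^sup>+\<^sup>1\<close>, the integrand is at most \<open>2\<^sup>(\<^sup>k\<^sup>+\<^sup>1\<^sup>)\<^sup>\<kappa>\<close>,
  and that region eventually has measure at most \<open>2\<^sup>-\<^sup>k\<^sup>g\<close>.\<close>

lemma (in finite_measure) moment_finite_of_tail:
  fixes X :: "'a \<Rightarrow> real"
  assumes [measurable]: "X \<in> borel_measurable M" and pos: "AE w in M. 0 < X w"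
    and tail: "\<forall>\<^sub>F x in at_top. measure M {w \<in> space M. x \<le> X w} \<le> x powr - g"
    and "0 < \<kappa>" "\<kappa> < g"
  shows "(\<integral>\<^sup>+w. ennreal (X w powr \<kappa>) \<partial>M) < \<infinity>"
proof -
  let ?A = "\<lambda>k::nat. {w \<in> space M. 2 ^ k \<le> X w}"
  let ?c = "\<lambda>k::nat. 2 powr \<kappa> * (2 powr \<kappa>) ^ k"
  have "AE w in M. ennreal (X w powr \<kappa>) \<le> 1 + (\<Sum>k. ennreal (?c k) * indicator (?A k) w)"
    using pos AE_space
  proof eventually_elim
    case (elim w)
    show ?case
    proof (cases "1 \<le> X w")
      case True
      then obtain k where k: "2 ^ k \<le> X w" "X w < 2 ^ Suc k" using dyadic_scale by blast
      have "X w powr \<kappa> \<le> (2 ^ Suc k) powr \<kappa>"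
        using k elim \<open>0 < \<kappa>\<close> by (intro powr_mono2) auto
      also have "\<dots> = ?c k" unfolding two_powr_nat by simp
      finally have "ennreal (X w powr \<kappa>) \<le> ennreal (?c k) * indicator (?A k) w"
        using k elim by (simp add: ennreal_leI)
      also have "\<dots> \<le> (\<Sum>k. ennreal (?c k) * indicator (?A k) w)"
        by (rule le_suminf_ennreal)
      finally show ?thesis by (simp add: add_increasing)
    next
      case False
      then have "X w powr \<kappa> \<le> 1"
        using elim \<open>0 < \<kappa>\<close> powr_mono2[of \<kappa> "X w" 1] by auto
      then have "ennreal (X w powr \<kappa>) \<le> 1" by simp
      then show ?thesis by (rule add_increasing2[rotated]) simp
    qed
  qed
  then have "(\<integral>\<^sup>+w. ennreal (X w powr \<kappa>) \<partial>M)
      \<le> (\<integral>\<^sup>+w. (1 + (\<Sum>k. ennreal (?c k) * indicator (?A k) w)) \<partial>M)"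
    by (rule nn_integral_mono_AE)
  also have "\<dots> = emeasure M (space M) + (\<Sum>k. ennreal (?c k) * emeasure M (?A k))"
    by (subst nn_integral_add) (auto simp: nn_integral_suminf nn_integral_cmult_indicator)
  also have "(\<Sum>k. ennreal (?c k) * emeasure M (?A k)) = (\<Sum>k. ennreal (?c k * measure M (?A k)))"
    by (simp add: emeasure_eq_measure ennreal_mult')
  also have "emeasure M (space M) + \<dots> < \<infinity>"
  proof -
    have "summable (\<lambda>k. ?c k * measure M (?A k))"
    proof (rule summable_comparison_test_ev)
      show "summable (\<lambda>k. 2 powr \<kappa> * (2 powr (\<kappa> - g)) ^ k)"
        using \<open>\<kappa> < g\<close> by (intro summable_mult summable_geometric) (simp add: powr_less_one)
      have "\<forall>\<^sub>F k in sequentially. measure M (?A k) \<le> (2 ^ k) powr - g"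
        using filterlim_iff[THEN iffD1, OF filterlim_real_power_at_top[of 2, simplified], rule_format, OF tail] .
      then show "\<forall>\<^sub>F k in sequentially. norm (?c k * measure M (?A k)) \<le> 2 powr \<kappa> * (2 powr (\<kappa> - g)) ^ k"
      proof eventually_elim
        case (elim k)
        then have "?c k * measure M (?A k) \<le> ?c k * (2 powr - g) ^ k"
          unfolding two_powr_nat by (intro mult_left_mono) auto
        also have "\<dots> = 2 powr \<kappa> * (2 powr (\<kappa> - g)) ^ k"
          by (simp add: power_mult_distrib[symmetric] powr_add[symmetric])
        finally show ?case by simp
      qed
    qed
    then show ?thesis
      by (subst suminf_ennreal2) (auto simp: emeasure_eq_measure)
  qed
  finally show ?thesis .
qed

lemma (in prob_space) polynomial_noise_tail:
  fixes X :: "'a \<Rightarrow> real"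
  assumes [measurable]: "X \<in> borel_measurable M" and int: "integrable M (\<lambda>w. X w powr \<zeta>)" and "0 < \<zeta>" "0 < s"
  shows "prob {w \<in> space M. s < X w} \<le> (\<integral>w. X w powr \<zeta> \<partial>M) * s powr - \<zeta>"
proof -
  have "prob {w \<in> space M. s < X w} \<le> prob {w \<in> space M. s powr \<zeta> \<le> X w powr \<zeta>}"
    using assms by (intro finite_measure_mono) (auto intro!: powr_mono2)
  also have "\<dots> \<le> (\<integral>w. X w powr \<zeta> \<partial>M) / s powr \<zeta>"
    using \<open>0 < s\<close> by (intro integral_Markov_inequality_measure[OF int, of "{}"]) auto
  finally show ?thesis by (simp add: powr_minus_divide)
qed

lemma measure_Un3_le:
  assumes "A \<in> sets M" "B \<in> sets M" "C \<in> sets M"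
  shows "measure M (A \<union> B \<union> C) \<le> measure M A + measure M B + measure M C"
  using measure_Un_le[of "A \<union> B" M C] measure_Un_le[of A M B] assms by auto

lemma small_left_tail:
  fixes M :: "real measure"
  assumes "finite_measure M" and [simp]: "sets M = sets borel" and pos: "AE v in M. 0 < v" and "0 < \<delta>"
  shows "\<exists>v>0. measure M {..<v} \<le> \<delta>"
proof -
  interpret finite_measure M by fact
  let ?A = "\<lambda>n. {..<1 / real (Suc n)}"
  have "(\<lambda>n. measure M (?A n)) \<longlonglongrightarrow> measure M (\<Inter>n. ?A n)"
    by (intro finite_Lim_measure_decseq) (auto simp: decseq_def field_simps intro: less_le_trans)
  also have "(\<Inter>n. ?A n) = {..0}"
  proof (intro equalityI subsetI)
    fix x assume x: "x \<in> (\<Inter>n. ?A n)"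
    show "x \<in> {..0}"
    proof (rule ccontr)
      assume "x \<notin> {..0}"
      then obtain n where "1 / real (Suc n) < x" using reals_Archimedean[of x] by (auto simp: inverse_eq_divide)
      with x show False by (auto dest: bspec[of _ _ n] less_asym)
    qed
  qed (auto intro: le_less_trans)
  also have "measure M {..0} = 0"
  proof -
    have "{v \<in> space M. \<not> 0 < v} = {..0}"
      using sets_eq_imp_space_eq[OF assms(2)] by auto
    then have "{..0} \<in> null_sets M" using pos by (subst (asm) AE_iff_null) auto
    then show ?thesis by (auto simp: measure_def)
  qed
  finally have "\<forall>\<^sub>F n in sequentially. measure M (?A n) < \<delta>"
    using \<open>0 < \<delta>\<close> by (auto dest: order_tendstoD(2))
  then obtain n where "measure M (?A n) < \<delta>" by (auto simp: eventually_sequentially)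
  then show ?thesis by (intro exI[of _ "1 / real (Suc n)"]) auto
qed

lemma small_right_tail:
  fixes M :: "real measure"
  assumes "finite_measure M" and [simp]: "sets M = sets borel" and "0 < \<delta>"
  shows "\<exists>s\<ge>0. measure M {s::real<..} \<le> \<delta>"
proof -
  interpret finite_measure M by fact
  let ?A = "\<lambda>n. {real n<..}"
  have "(\<lambda>n. measure M (?A n)) \<longlonglongrightarrow> measure M (\<Inter>n. ?A n)"
    by (intro finite_Lim_measure_decseq) (auto simp: decseq_def)
  also have "(\<Inter>n. ?A n) = {}"
  proof -
    have "\<exists>n. x \<notin> ?A n" for x :: real using reals_Archimedean2[of x] by (metis greaterThan_iff less_asym)
    then show ?thesis by blast
  qed
  finally have "\<forall>\<^sub>F n in sequentially. measure M (?A n) < \<delta>"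
    using \<open>0 < \<delta>\<close> by (auto dest: order_tendstoD(2))
  then obtain n where "measure M (?A n) < \<delta>" by (auto simp: eventually_sequentially)
  then show ?thesis by (intro exI[of _ "real n"]) auto
qed

text \<open>With \<open>x = n p\<close> this follows from \<open>exp (- x) \<cdot> x \<le> 1\<close>: a polynomial substitute for the exponential
  decay of the probability that \<open>n\<close> independent attempts all fail.\<close>

lemma power_one_minus_times_le:
  fixes p :: real
  assumes "0 \<le> p" "p \<le> 1"
  shows "(1 - p) ^ n * (real n * p) \<le> 1"
proof -
  have "1 - p \<le> exp (- p)" using exp_ge_add_one_self[of "- p"] by simp
  then have "(1 - p) ^ n \<le> exp (- p) ^ n" using assms by (intro power_mono) auto
  also have "\<dots> = exp (- (real n * p))" by (simp add: exp_of_nat_mult[symmetric])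
  finally have "(1 - p) ^ n * (real n * p) \<le> exp (- (real n * p)) * exp (real n * p)"
    using assms order_trans[OF _ exp_ge_add_one_self[of "real n * p"], of "real n * p"] by (intro mult_mono) auto
  then show ?thesis by (simp add: exp_minus)
qed

text \<open>If a vertex of a cube of side \<open>2\<^sup>k\<close> is heavy with probability \<open>p k \<ge> 2\<^sup>-\<^sup>k\<^sup>\<beta>\<close>, then the cube contains
  at least \<open>2\<^sup>k\<^sup>(\<^sup>d\<^sup>-\<^sup>\<beta>\<^sup>)\<close> heavy vertices on average, and having none of them is summably unlikely.\<close>

lemma sparse_summable:
  fixes p :: "nat \<Rightarrow> real"
  assumes p: "\<And>k. 0 \<le> p k" "\<And>k. p k \<le> 1"
    and lower: "\<forall>\<^sub>F k in sequentially. (2 powr - \<beta>) ^ k \<le> p k" and "\<beta> < real d"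
  shows "summable (\<lambda>k. (1 - p k) ^ ((2 ^ k) ^ d))"
proof (rule summable_comparison_test_ev)
  show "summable (\<lambda>k. (2 powr (\<beta> - d)) ^ k)"
    using assms by (intro summable_geometric) (simp add: powr_less_one)
  show "\<forall>\<^sub>F k in sequentially. norm ((1 - p k) ^ ((2 ^ k) ^ d)) \<le> (2 powr (\<beta> - d)) ^ k"
    using lower
  proof eventually_elim
    case (elim k)
    let ?n = "(2 ^ k) ^ d :: nat"
    have n: "real ?n = (2 powr d) ^ k"
      by (simp add: powr_realpow power_mult[symmetric] mult.commute)
    have "(1 - p k) ^ ?n * (2 powr (d - \<beta>)) ^ k = (1 - p k) ^ ?n * (real ?n * (2 powr - \<beta>) ^ k)"
      unfolding n power_mult_distrib[symmetric] powr_add[symmetric] by simp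
    also have "\<dots> \<le> (1 - p k) ^ ?n * (real ?n * p k)"
      using elim p by (intro mult_left_mono) auto
    also have "\<dots> \<le> 1" using p by (rule power_one_minus_times_le)
    finally have "(1 - p k) ^ ?n \<le> 1 / (2 powr (d - \<beta>)) ^ k"
      by (simp add: pos_le_divide_eq)
    also have "\<dots> = (2 powr (\<beta> - d)) ^ k"
      by (simp add: power_one_over[symmetric] powr_minus_divide[symmetric])
    finally show ?case using p by simp
  qed
qed

section \<open>No fast edge at the origin\<close>

context ilrfpp
begin

lemma sets_nu [simp, measurable_cong]: "sets \<nu> = sets borel"
  using law_V[of undefined] by auto

lemma edge_iff: "{x, y} \<in> edges \<longleftrightarrow> x \<noteq> y"
  by (auto simp: edges_def card_insert_if)

lemma prob_space_nu: "prob_space \<nu>"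
  using law_V[of 0] prob_space_distr[OF measurable_V] by metis

lemma ex_edge: "\<exists>y. {0, y :: int ^ 'd} \<in> edges"
  by (rule exI[of _ "\<chi> i. 1"]) (simp add: edge_iff vec_eq_iff)

lemma sets_mu [simp, measurable_cong]: "sets \<mu> = sets borel"
  using ex_edge law_N by (metis sets_distr)

lemma prob_space_mu: "prob_space \<mu>"
  using ex_edge law_N prob_space_distr[OF measurable_N] by metis

lemma AE_all_V:
  assumes "AE v in \<nu>. P v"
  shows "AE w in M. \<forall>x\<in>UNIV. P (V x w)"
proof (rule AE_ball_countable'[OF _ countable_UNIV_int_vec])
  show "AE w in M. P (V x w)" for x
    by (rule AE_distrD[OF measurable_V]) (unfold law_V, rule assms)
qed

lemma AE_all_N:
  assumes "AE r in \<mu>. P r"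
  shows "AE w in M. \<forall>y\<in>UNIV - {x}. P (N {x, y} w)"
proof (rule AE_ball_countable')
  show "AE w in M. P (N {x, y} w)" if "y \<in> UNIV - {x}" for y
    using that assms law_N[of "{x, y}"] by (intro AE_distrD[OF measurable_N]) (auto simp: edge_iff)
  show "countable (UNIV - {x} :: (int ^ 'd) set)"
    using countable_UNIV_int_vec by (rule countable_subset[rotated]) auto
qed

text \<open>The reciprocal edge time raised to a power factorises into a noise and two weights with
  different indices, which are jointly independent.\<close>

lemma nn_integral_edge_weight:
  fixes x y :: "int ^ 'd"
  assumes "x \<noteq> y" and [measurable]: "f \<in> borel_measurable borel" "g \<in> borel_measurable borel"
  shows "(\<integral>\<^sup>+w. f (N {x, y} w) * (g (V x w) * g (V y w)) \<partial>M)
     = (\<integral>\<^sup>+r. f r \<partial>\<mu>) * ((\<integral>\<^sup>+v. g v \<partial>\<nu>) * (\<integral>\<^sup>+v. g v \<partial>\<nu>))"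
proof -
  let ?J = "{Inr {x, y}, Inl x, Inl y} :: (int ^ 'd + (int ^ 'd) set) set"
  define Y where "Y = case_sum (\<lambda>_::int ^ 'd. g) (\<lambda>_::(int ^ 'd) set. f)"
  have e: "{x, y} \<in> edges" using assms by (simp add: edge_iff)
  have "indep_vars (\<lambda>_. borel) (\<lambda>i w. Y i (case_sum V N i w)) ?J"
    using e by (intro indep_vars_compose2[OF indep_vars_subset[OF indep]])
      (auto simp: Y_def split: sum.split)
  then have "(\<integral>\<^sup>+w. (\<Prod>i\<in>?J. Y i (case_sum V N i w)) \<partial>M) = (\<Prod>i\<in>?J. \<integral>\<^sup>+w. Y i (case_sum V N i w) \<partial>M)"
    by (intro indep_vars_nn_integral) auto
  moreover have "(\<integral>\<^sup>+w. g (V z w) \<partial>M) = (\<integral>\<^sup>+v. g v \<partial>\<nu>)" for z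
    using measurable_V by (subst law_V[of z, symmetric]) (simp add: nn_integral_distr)
  moreover have "(\<integral>\<^sup>+w. f (N {x, y} w) \<partial>M) = (\<integral>\<^sup>+v. f v \<partial>\<mu>)"
    using measurable_N[OF e] by (subst law_N[OF e, symmetric]) (simp add: nn_integral_distr)
  ultimately show ?thesis using \<open>x \<noteq> y\<close> by (simp add: Y_def)
qed

text \<open>The first edge of a nearly optimal path is such an edge.\<close>

lemma passage_time_less_imp_edge:
  assumes "x \<noteq> u" "passage_time \<alpha> V N x u w < c"
  shows "\<exists>y. y \<noteq> x \<and> edge_time \<alpha> V N w x y < c"
proof -
  from assms(2) obtain p where p: "p \<in> paths x u" "path_time (edge_time \<alpha> V N w) p < c"
    unfolding passage_time_def INF_less_iff by blast
  then obtain q where q: "p = x # q" by (cases p) (auto simp: paths_def)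
  with p assms(1) obtain y r where "q = y # r" by (cases q) (auto simp: paths_def)
  with p q have "y \<noteq> x" "edge_time \<alpha> V N w x y + path_time (edge_time \<alpha> V N w) (y # r) < c"
    by (auto simp: paths_def path_time_Cons)
  moreover have "edge_time \<alpha> V N w x y \<le> edge_time \<alpha> V N w x y + path_time (edge_time \<alpha> V N w) (y # r)"
    by simp
  ultimately show ?thesis by (meson order_le_less_trans)
qed

text \<open>The form in which Markov's inequality is applied: the right-hand side is the reciprocal edge
  time to the power \<open>\<kappa>\<close>.\<close>

lemma fast_edge_cost:
  assumes "x \<noteq> y" "0 < V x w" "0 < V y w" "0 < N {x, y} w" "0 < \<kappa>" "0 < t"
    and less: "edge_time \<alpha> V N w x y < ennreal t"
  shows "t powr - \<kappa> \<le> l1_norm (x - y) powr - (\<alpha> * \<kappa>) * (N {x, y} w powr - \<kappa> * (V x w powr \<kappa> * V y w powr \<kappa>))"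
proof -
  have l: "0 < l1_norm (x - y)" using l1_norm_ge_1[of "x - y"] assms(1) by simp
  let ?r = "l1_norm (x - y) powr \<alpha> * N {x, y} w / (V x w * V y w)"
  have "0 < ?r" using assms l by simp
  moreover from less have "?r < t" using \<open>0 < t\<close> \<open>0 < ?r\<close> unfolding edge_time_def by (simp add: ennreal_less_iff)
  ultimately have "t powr - \<kappa> \<le> ?r powr - \<kappa>" using \<open>0 < \<kappa>\<close> by (intro powr_mono2') auto
  also have "\<dots> = l1_norm (x - y) powr - (\<alpha> * \<kappa>) * (N {x, y} w powr - \<kappa> * (V x w powr \<kappa> * V y w powr \<kappa>))"
    using assms l by (simp add: powr_mult powr_divide powr_powr powr_minus field_simps)
  finally show ?thesis .
qed

text \<open>Markov's inequality for the sum of \<open>W\<^sub>0\<^sub>y\<^sup>-\<^sup>\<kappa>\<close> over \<open>y \<noteq> 0\<close>: an edge time below \<open>t\<close> pushes this sum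
  above \<open>t\<^sup>-\<^sup>\<kappa>\<close>. The argument bounds the probability of \<open>T < s\<close>, because an infimum attaining its
  value \<open>t\<close> need not come with an edge of cost at most \<open>t\<close>; letting \<open>s\<close> decrease to \<open>t\<close> then also
  covers \<open>t = 0\<close>.\<close>

proposition passage_time_small_prob:
  assumes "0 < \<kappa>" and dim: "real CARD('d) < \<alpha> * \<kappa>"
    and V_pos: "AE v in \<nu>. 0 < v" and N_pos: "AE r in \<mu>. 0 < r"
    and V_moment: "(\<integral>\<^sup>+v. ennreal (v powr \<kappa>) \<partial>\<nu>) < \<infinity>"
    and N_moment: "(\<integral>\<^sup>+r. ennreal (r powr - \<kappa>) \<partial>\<mu>) < \<infinity>"
  shows "\<exists>C\<ge>0. \<forall>u t. u \<noteq> 0 \<longrightarrow> 0 \<le> t \<longrightarrow>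
     \<P>(w in M. passage_time \<alpha> V N 0 u w \<le> ennreal t) \<le> C * t powr \<kappa>"
proof -
  let ?Z = "count_space (UNIV - {0 :: int ^ 'd})"
  define g where "g y w = ennreal (l1_norm y powr - (\<alpha> * \<kappa>)) *
    (ennreal (N {0, y} w powr - \<kappa>) * (ennreal (V 0 w powr \<kappa>) * ennreal (V y w powr \<kappa>)))" for y w
  define S where "S w = (\<integral>\<^sup>+y. g y w \<partial>?Z)" for w
  have [measurable]: "V y \<in> borel_measurable M" for y by (rule measurable_V)
  have [measurable]: "N {0, y} \<in> borel_measurable M" if "y \<in> UNIV - {0}" for y
    using that by (intro measurable_N) (simp add: edge_iff)
  have cnt: "countable (UNIV - {0 :: int ^ 'd})"
    using countable_UNIV_int_vec by (rule countable_subset[rotated]) auto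
  have g_meas [measurable]: "g y \<in> borel_measurable M" if "y \<in> UNIV - {0}" for y
    using that unfolding g_def by measurable
  have "(\<integral>\<^sup>+w. S w \<partial>M) = (\<integral>\<^sup>+y. \<integral>\<^sup>+w. g y w \<partial>M \<partial>?Z)"
    unfolding S_def by (rule nn_integral_count_space_nn_integral[OF cnt g_meas])
  also have "\<dots> = (\<integral>\<^sup>+y. ennreal (l1_norm y powr - (\<alpha> * \<kappa>)) *
      ((\<integral>\<^sup>+r. ennreal (r powr - \<kappa>) \<partial>\<mu>) * ((\<integral>\<^sup>+v. ennreal (v powr \<kappa>) \<partial>\<nu>) * (\<integral>\<^sup>+v. ennreal (v powr \<kappa>) \<partial>\<nu>))) \<partial>?Z)"
    by (intro nn_integral_cong)
       (auto simp: g_def nn_integral_cmult nn_integral_edge_weight[where f = "\<lambda>r. ennreal (r powr - \<kappa>)" and g = "\<lambda>v. ennreal (v powr \<kappa>)"])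
  also have "\<dots> < \<infinity>"
    using lattice_sum_finite[OF dim] V_moment N_moment
    by (subst nn_integral_multc) (auto simp: ennreal_mult_less_top)
  finally obtain C where C: "0 \<le> C" "(\<integral>\<^sup>+w. S w \<partial>M) = ennreal C"
    by (cases "\<integral>\<^sup>+w. S w \<partial>M") auto
  have strict: "\<P>(w in M. passage_time \<alpha> V N 0 u w < ennreal t) \<le> C * t powr \<kappa>"
    if "u \<noteq> 0" "0 < t" for u t
  proof -
    let ?E = "{w \<in> space M. passage_time \<alpha> V N 0 u w < ennreal t}"
    have [measurable]: "passage_time \<alpha> V N 0 u \<in> borel_measurable M" by (rule measurable_passage_time)
    have integral_E: "ennreal (t powr - \<kappa> * prob ?E) = (\<integral>\<^sup>+w. ennreal (t powr - \<kappa>) * indicator ?E w \<partial>M)"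
      by (subst nn_integral_cmult_indicator) (auto simp: emeasure_eq_measure ennreal_mult')
    have "AE w in M. ennreal (t powr - \<kappa>) * indicator ?E w \<le> S w"
      using AE_all_V[OF V_pos] AE_all_N[OF N_pos, of 0]
    proof eventually_elim
      case (elim w)
      show ?case
      proof (cases "w \<in> ?E")
        case True
        then obtain y where y: "y \<noteq> 0" "edge_time \<alpha> V N w 0 y < ennreal t"
          using passage_time_less_imp_edge[of 0 u w] \<open>u \<noteq> 0\<close> by auto
        have "t powr - \<kappa> \<le> l1_norm (0 - y) powr - (\<alpha> * \<kappa>) * (N {0, y} w powr - \<kappa> * (V 0 w powr \<kappa> * V y w powr \<kappa>))"
          using elim y that \<open>0 < \<kappa>\<close> by (intro fast_edge_cost) auto
        then have "ennreal (t powr - \<kappa>) \<le> g y w"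
          unfolding g_def l1_norm_minus_commute[of 0 y]
          by (simp add: ennreal_mult[symmetric] ennreal_leI)
        also have "\<dots> \<le> S w" unfolding S_def using y by (intro nn_integral_ge_point) auto
        finally show ?thesis using True by simp
      qed simp
    qed
    then have "ennreal (t powr - \<kappa> * prob ?E) \<le> (\<integral>\<^sup>+w. S w \<partial>M)"
      unfolding integral_E by (rule nn_integral_mono_AE)
    then have "t powr - \<kappa> * prob ?E \<le> C" using C by simp
    then show ?thesis using \<open>0 < t\<close> by (simp add: powr_minus field_simps)
  qed
  have "\<P>(w in M. passage_time \<alpha> V N 0 u w \<le> ennreal t) \<le> C * t powr \<kappa>"
    if "u \<noteq> 0" "0 \<le> t" for u t
  proof (rule tendsto_lowerbound)
    show "((\<lambda>s. C * s powr \<kappa>) \<longlongrightarrow> C * t powr \<kappa>) (at_right t)"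
      using that \<open>0 < \<kappa>\<close> by (intro tendsto_intros tendsto_powr') (auto simp: eventually_at_right_less eventually_at_filter)
    show "\<forall>\<^sub>F s in at_right t. \<P>(w in M. passage_time \<alpha> V N 0 u w \<le> ennreal t) \<le> C * s powr \<kappa>"
    proof (rule eventually_at_rightI[of t "t + 1"])
      fix s assume s: "s \<in> {t<..<t + 1}"
      have [measurable]: "passage_time \<alpha> V N 0 u \<in> borel_measurable M" by (rule measurable_passage_time)
      have "\<P>(w in M. passage_time \<alpha> V N 0 u w \<le> ennreal t) \<le> \<P>(w in M. passage_time \<alpha> V N 0 u w < ennreal s)"
        using s that by (intro finite_measure_mono) (auto intro: order_le_less_trans simp: ennreal_less_iff)
      also have "\<dots> \<le> C * s powr \<kappa>" using s that by (intro strict) auto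
      finally show "\<P>(w in M. passage_time \<alpha> V N 0 u w \<le> ennreal t) \<le> C * s powr \<kappa>" .
    qed simp
  qed simp
  with C show ?thesis by blast
qed

end

section \<open>Edges between vertices selected by their weights\<close>

text \<open>The first vertex of \<open>A\<close>, in a fixed enumeration of the lattice, at which the configuration \<open>v\<close>
  reaches the level \<open>h\<close>. A least index, unlike an arbitrary choice, is evidently measurable
  in \<open>v\<close>; if no vertex of \<open>A\<close> qualifies, the value is an unspecified constant.\<close>

definition first_above :: "(int ^ 'd::finite) set \<Rightarrow> real \<Rightarrow> (int ^ 'd \<Rightarrow> real) \<Rightarrow> int ^ 'd" where
  "first_above A h v =
     from_nat_into UNIV (LEAST n. from_nat_into UNIV n \<in> A \<and> h \<le> v (from_nat_into UNIV n))"

lemma first_above: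
  assumes "a \<in> A" "h \<le> v a"
  shows "first_above A h v \<in> A" "h \<le> v (first_above A h v)"
proof -
  obtain n where "a = from_nat_into UNIV n"
    using from_nat_into_surj[OF countable_UNIV_int_vec, of a] by auto
  with assms have "\<exists>n. from_nat_into UNIV n \<in> A \<and> h \<le> v (from_nat_into UNIV n)" by auto
  from LeastI_ex[OF this] show "first_above A h v \<in> A" "h \<le> v (first_above A h v)"
    unfolding first_above_def by auto
qed

lemma measurable_first_above:
  "first_above A h \<in> measurable (PiM UNIV (\<lambda>_. borel)) (count_space UNIV)"
  unfolding first_above_def
  by (rule measurable_compose[OF measurable_Least]) auto

context ilrfpp
begin

text \<open>All weights enter as one random configuration, so that the lemma applies to events depending on
  infinitely many of them, such as the position of a selected vertex.\<close>

lemma indep_weights_noise: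
  assumes e: "e \<in> edges" and D: "D \<in> sets (PiM UNIV (\<lambda>_. borel))" and B: "B \<in> sets borel"
  shows "prob {w \<in> space M. (\<lambda>x. V x w) \<in> D \<and> N e w \<in> B}
    = prob {w \<in> space M. (\<lambda>x. V x w) \<in> D} * prob {w \<in> space M. N e w \<in> B}"
proof -
  let ?L = "range Inl :: (int ^ 'd + (int ^ 'd) set) set"
  let ?R = "{Inr e} :: (int ^ 'd + (int ^ 'd) set) set"
  let ?PL = "PiM ?L (\<lambda>_. borel :: real measure)" and ?PR = "PiM ?R (\<lambda>_. borel :: real measure)"
  define D' where "D' = (\<lambda>g x. g (Inl x)) -` D \<inter> space ?PL"
  define B' where "B' = (\<lambda>g. g (Inr e)) -` B \<inter> space ?PR"
  have "(\<lambda>g x. g (Inl x)) \<in> measurable ?PL (PiM UNIV (\<lambda>_. borel :: real measure))"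
    by (rule measurable_PiM_single') (auto simp: space_PiM intro!: measurable_component_singleton)
  then have D': "D' \<in> sets ?PL" unfolding D'_def using D by (rule measurable_sets)
  have "(\<lambda>g. g (Inr e)) \<in> measurable ?PR (borel :: real measure)"
    by (rule measurable_component_singleton) simp
  then have B': "B' \<in> sets ?PR" unfolding B'_def using B by (rule measurable_sets)
  have "indep_var ?PL (\<lambda>w. \<lambda>i\<in>?L. case_sum V N i w) ?PR (\<lambda>w. \<lambda>i\<in>?R. case_sum V N i w)"
    using e by (intro indep_var_restrict[OF indep]) auto
  from indep_varD[OF this D' B'] show ?thesis
    unfolding D'_def B'_def by (simp add: vimage_def Int_def space_PiM conj_commute)
qed

text \<open>Choosing the endpoints by the weights does not bias the noise between them: condition on the
  countably many values \<open>(i, j)\<close> of the endpoints, each an event independent of the noise at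
  \<open>{i, j}\<close>. The case \<open>a = b\<close> is left out because a single vertex is not an edge; the
  corresponding step of a walk is free.\<close>

lemma selected_noise:
  fixes s :: real
  assumes a: "a \<in> measurable (PiM UNIV (\<lambda>_. borel)) (count_space UNIV)"
    and b: "b \<in> measurable (PiM UNIV (\<lambda>_. borel)) (count_space UNIV)"
  defines "E \<equiv> {w \<in> space M. a (\<lambda>x. V x w) \<noteq> b (\<lambda>x. V x w) \<and> s < N {a (\<lambda>x. V x w), b (\<lambda>x. V x w)} w}"
  shows "E \<in> events" "prob E \<le> measure \<mu> {s<..}"
proof -
  let ?P = "PiM (UNIV :: (int ^ 'd) set) (\<lambda>_. borel :: real measure)"
  let ?v = "\<lambda>w x. V x w"
  define I where "I = {ij :: (int ^ 'd) \<times> (int ^ 'd). fst ij \<noteq> snd ij}"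
  define D where "D ij = {v \<in> space ?P. a v = fst ij \<and> b v = snd ij}" for ij
  define F where "F ij = {w \<in> space M. ?v w \<in> D ij}" for ij
  define G where "G ij = {w \<in> space M. s < N {fst ij, snd ij} w}" for ij
  have I: "countable I"
    using countable_SIGMA[OF countable_UNIV_int_vec countable_UNIV_int_vec]
    by (rule countable_subset[rotated]) auto
  have D: "D ij \<in> sets ?P" for ij
  proof -
    have "D ij = (a -` {fst ij} \<inter> space ?P) \<inter> (b -` {snd ij} \<inter> space ?P)"
      unfolding D_def by auto
    then show ?thesis using measurable_sets[OF a] measurable_sets[OF b] by auto
  qed
  have v: "?v \<in> measurable M ?P"
    by (rule measurable_PiM_single') (auto simp: measurable_V)
  have F: "F ij \<in> events" for ij
    using measurable_sets[OF v D[of ij]] unfolding F_def by (simp add: vimage_def Int_def conj_commute)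
  have G: "G ij \<in> events" if "ij \<in> I" for ij
    using measurable_N[of "{fst ij, snd ij}"] that unfolding G_def I_def by (auto simp: edge_iff)
  have disj: "disjoint_family_on F I"
    unfolding disjoint_family_on_def F_def D_def by (auto simp: prod_eq_iff)
  then have disj': "disjoint_family_on (\<lambda>ij. F ij \<inter> G ij) I"
    by (rule disjoint_family_on_bisimulation) auto
  have E_eq: "E = (\<Union>ij\<in>I. F ij \<inter> G ij)"
    unfolding E_def F_def G_def D_def I_def by (auto simp: space_PiM)
  show "E \<in> events" unfolding E_eq using I F G by (intro sets.countable_UN') auto
  have FG: "emeasure M (F ij \<inter> G ij) = emeasure M (F ij) * ennreal (measure \<mu> {s<..})" if ij: "ij \<in> I" for ij
  proof -
    have e: "{fst ij, snd ij} \<in> edges" using ij by (simp add: I_def edge_iff)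
    have "prob (F ij \<inter> G ij) = prob (F ij) * prob (G ij)"
      using indep_weights_noise[OF e D[of ij], of "{s<..}"]
      unfolding F_def G_def by (simp add: Int_def conj_ac)
    also have "prob (G ij) = measure \<mu> {s<..}"
      unfolding law_N[OF e, symmetric] G_def
      by (subst measure_distr) (auto simp: measurable_N[OF e] vimage_def Int_def conj_commute)
    finally show ?thesis by (simp add: emeasure_eq_measure ennreal_mult')
  qed
  have "emeasure M E = (\<integral>\<^sup>+ij. emeasure M (F ij \<inter> G ij) \<partial>count_space I)"
    unfolding E_eq using I F G disj'
    by (intro emeasure_UN_countable) auto
  also have "\<dots> = (\<integral>\<^sup>+ij. emeasure M (F ij) * ennreal (measure \<mu> {s<..}) \<partial>count_space I)"
    by (intro nn_integral_cong) (simp add: FG)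
  also have "\<dots> = emeasure M (\<Union>ij\<in>I. F ij) * ennreal (measure \<mu> {s<..})"
    using I F disj by (simp add: nn_integral_multc emeasure_UN_countable)
  also have "\<dots> \<le> 1 * ennreal (measure \<mu> {s<..})"
    by (intro mult_right_mono emeasure_le_1) auto
  finally show "prob E \<le> measure \<mu> {s<..}" by (simp add: emeasure_eq_measure)
qed

lemma all_below:
  fixes h :: real
  assumes "finite A" "A \<noteq> {}"
  defines "E \<equiv> {w \<in> space M. \<forall>a\<in>A. V a w < h}"
  shows "E \<in> events" "prob E = (1 - measure \<nu> {h..}) ^ card A"
proof -
  interpret nu: prob_space \<nu> by (rule prob_space_nu)
  have [measurable]: "V x \<in> borel_measurable M" for x by (rule measurable_V)
  show "E \<in> events" unfolding E_def using assms(1) by measurable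
  have "E = (\<Inter>i\<in>Inl ` A. case_sum V N i -` {..<h} \<inter> space M)"
    unfolding E_def using assms(2) by auto
  also have "prob \<dots> = (\<Prod>i\<in>Inl ` A. prob (case_sum V N i -` {..<h} \<inter> space M))"
    using assms(1,2) by (intro indep_varsD[OF indep]) auto
  also have "\<dots> = (\<Prod>a\<in>A. prob (V a -` {..<h} \<inter> space M))"
    by (subst prod.reindex) auto
  also have "\<dots> = (\<Prod>a\<in>A. measure \<nu> {..<h})"
    by (intro prod.cong refl) (subst law_V[symmetric], simp add: measure_distr)
  also have "measure \<nu> {..<h} = 1 - measure \<nu> {h..}"
  proof -
    have "space \<nu> = UNIV" using sets_eq_imp_space_eq[OF sets_nu] by simp
    moreover have "{..<h} = UNIV - {h..}" by auto
    ultimately show ?thesis using nu.prob_compl[of "{h..}"] by simp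
  qed
  finally show "prob E = (1 - measure \<nu> {h..}) ^ card A" by simp
qed

end

section \<open>Chains of heavy vertices\<close>

lemma edge_time_le:
  assumes "l1_norm (x - y) \<le> D" "0 < a" "a \<le> V x w" "0 < b" "b \<le> V y w"
    and "x \<noteq> y \<Longrightarrow> N {x, y} w \<le> s" "0 \<le> s" "0 \<le> \<alpha>"
  shows "edge_time \<alpha> V N w x y \<le> ennreal (D powr \<alpha> * s / (a * b))"
proof (cases "x = y")
  case True
  then show ?thesis by (simp add: edge_time_def l1_norm_def)
next
  case False
  have "l1_norm (x - y) powr \<alpha> * N {x, y} w / (V x w * V y w) \<le> l1_norm (x - y) powr \<alpha> * s / (V x w * V y w)"
    using assms False by (intro divide_right_mono mult_left_mono) auto
  also have "\<dots> \<le> D powr \<alpha> * s / (a * b)"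
    using assms l1_norm_nonneg[of "x - y"] by (intro frac_le mult_mono powr_mono2 mult_nonneg_nonneg mult_pos_pos) auto
  finally show ?thesis unfolding edge_time_def by (rule ennreal_leI)
qed

text \<open>The balance behind the choice of \<open>\<rho>\<close>: distance \<open>2\<^sup>k\<close> and noise \<open>2\<^sup>k\<^sup>\<tau>\<close> are beaten by two weights
  \<open>2\<^sup>k\<^sup>\<rho>\<close>, leaving a decaying factor \<open>2\<^sup>-\<^sup>k\<^sup>\<tau>\<close>.\<close>

lemma scale_cost:
  fixes \<alpha> \<rho> \<tau> c :: real
  assumes "\<alpha> + 2 * \<tau> = 2 * \<rho>" "0 \<le> c"
  shows "(c * 2 ^ k) powr \<alpha> * (2 powr \<tau>) ^ k / ((2 powr \<rho>) ^ k * (2 powr \<rho>) ^ k) = c powr \<alpha> * (2 powr - \<tau>) ^ k"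
proof -
  have "(c * 2 ^ k) powr \<alpha> * (2 powr \<tau>) ^ k / ((2 powr \<rho>) ^ k * (2 powr \<rho>) ^ k)
     = c powr \<alpha> * ((2 powr \<alpha> * 2 powr \<tau>) / (2 powr \<rho> * 2 powr \<rho>)) ^ k"
    using assms by (simp add: powr_mult two_powr_nat power_mult_distrib power_divide)
  also have "(2 powr \<alpha> * 2 powr \<tau>) / (2 powr \<rho> * 2 powr \<rho>) = 2 powr (\<alpha> + \<tau> - (\<rho> + \<rho>))"
    by (simp only: powr_add powr_diff)
  also have "\<alpha> + \<tau> - (\<rho> + \<rho>) = - \<tau>" using assms by simp
  finally show ?thesis .
qed

lemma sum_geometric_le:
  fixes c r :: real
  assumes "0 \<le> c" "0 \<le> r" "r < 1" "finite A"
  shows "(\<Sum>k\<in>A. c * r ^ k) \<le> c / (1 - r)"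
proof -
  have "(\<Sum>k\<in>A. c * r ^ k) \<le> (\<Sum>k. c * r ^ k)"
    using assms by (intro sum_le_suminf summable_mult summable_geometric) auto
  also have "\<dots> = c / (1 - r)"
    using assms by (simp add: suminf_mult suminf_geometric summable_geometric)
  finally show ?thesis .
qed

text \<open>Going from \<open>z\<close> to a heavy vertex \<open>f m\<close> at a fixed scale costs at most a constant depending on
  \<open>m\<close>; from there on the steps up to scale \<open>K\<close> form a geometric series, so that the bound is
  independent of \<open>K\<close>. The reverse direction is needed for the chain that ends in \<open>u\<close>.\<close>

lemma chain_cost:
  fixes z :: "int ^ 'd::finite" and f :: "nat \<Rightarrow> int ^ 'd"
  assumes \<alpha>: "0 < \<alpha>" "\<alpha> + 2 * \<tau> = 2 * \<rho>" "0 < \<tau>" and "m \<le> K" "0 < v" "0 \<le> s"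
    and base: "v \<le> V z w" "z \<noteq> f m \<Longrightarrow> N {z, f m} w \<le> s"
    and site: "\<And>k. k \<in> {m..K} \<Longrightarrow> f k \<in> cube z k \<and> (2 powr \<rho>) ^ k \<le> V (f k) w"
    and noise: "\<And>k. k \<in> {m..<K} \<Longrightarrow> f k \<noteq> f (Suc k) \<Longrightarrow> N {f k, f (Suc k)} w \<le> (2 powr \<tau>) ^ k"
  defines "c \<equiv> 2 * real CARD('d)"
  defines "b \<equiv> ennreal ((c * 2 ^ m) powr \<alpha> * s / v + c powr \<alpha> / (1 - 2 powr - \<tau>))"
  shows "passage_time \<alpha> V N z (f K) w \<le> b" "passage_time \<alpha> V N (f K) z w \<le> b"
proof -
  let ?T = "\<lambda>x y. passage_time \<alpha> V N x y w" and ?W = "edge_time \<alpha> V N w"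
  have "0 < \<rho>" using \<alpha> by linarith
  then have \<rho>1: "1 \<le> 2 powr \<rho>" by (simp add: ge_one_powr_ge_zero)
  have c: "0 \<le> c" unfolding c_def by simp
  have r: "2 powr - \<tau> < 1" using \<alpha> by (simp add: powr_less_one)
  have first: "?W z (f m) \<le> ennreal ((c * 2 ^ m) powr \<alpha> * s / v)"
  proof -
    have "l1_norm (z - f m) \<le> real CARD('d) * 2 ^ m"
      using site[of m] \<open>m \<le> K\<close> by (intro l1_norm_diff_cube) (auto simp: base_in_cube)
    also have "\<dots> \<le> c * 2 ^ m" unfolding c_def by simp
    finally have "?W z (f m) \<le> ennreal ((c * 2 ^ m) powr \<alpha> * s / (v * (2 powr \<rho>) ^ m))"
      using site[of m] assms \<rho>1 by (intro edge_time_le) auto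
    also have "\<dots> \<le> ennreal ((c * 2 ^ m) powr \<alpha> * s / (v * 1))"
      using \<open>0 < v\<close> \<open>0 \<le> s\<close> \<rho>1 by (intro ennreal_leI divide_left_mono mult_left_mono one_le_power) auto
    finally show ?thesis by simp
  qed
  have step: "?W (f k) (f (Suc k)) \<le> ennreal (c powr \<alpha> * (2 powr - \<tau>) ^ k)" if k: "k \<in> {m..<K}" for k
  proof -
    have "l1_norm (f k - f (Suc k)) \<le> real CARD('d) * 2 ^ Suc k"
      using site[of k] site[of "Suc k"] k cube_mono[of k "Suc k" z] by (intro l1_norm_diff_cube) auto
    also have "\<dots> = c * 2 ^ k" unfolding c_def by simp
    finally have "?W (f k) (f (Suc k)) \<le> ennreal ((c * 2 ^ k) powr \<alpha> * (2 powr \<tau>) ^ k / ((2 powr \<rho>) ^ k * (2 powr \<rho>) ^ Suc k))"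
      using site[of k] site[of "Suc k"] k noise[of k] \<alpha> by (intro edge_time_le) auto
    also have "\<dots> \<le> ennreal ((c * 2 ^ k) powr \<alpha> * (2 powr \<tau>) ^ k / ((2 powr \<rho>) ^ k * (2 powr \<rho>) ^ k))"
      using \<rho>1 by (intro ennreal_leI divide_left_mono mult_left_mono power_increasing) auto
    finally show ?thesis unfolding scale_cost[OF \<alpha>(2) c] .
  qed
  have "(\<Sum>k\<in>{m..<K}. ?W (f k) (f (Suc k))) \<le> (\<Sum>k\<in>{m..<K}. ennreal (c powr \<alpha> * (2 powr - \<tau>) ^ k))"
    by (intro sum_mono step)
  also have "\<dots> = ennreal (\<Sum>k\<in>{m..<K}. c powr \<alpha> * (2 powr - \<tau>) ^ k)"
    by (rule sum_ennreal) simp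
  also have "\<dots> \<le> ennreal (c powr \<alpha> / (1 - 2 powr - \<tau>))"
    using r by (intro ennreal_leI sum_geometric_le) auto
  finally have chain: "(\<Sum>k\<in>{m..<K}. ?W (f k) (f (Suc k))) \<le> ennreal (c powr \<alpha> / (1 - 2 powr - \<tau>))" .
  have b: "b = ennreal ((c * 2 ^ m) powr \<alpha> * s / v) + ennreal (c powr \<alpha> / (1 - 2 powr - \<tau>))"
    unfolding b_def using \<open>0 < v\<close> \<open>0 \<le> s\<close> r by (intro ennreal_plus) auto
  have "?T z (f K) \<le> ?T z (f m) + ?T (f m) (f K)" by (rule passage_time_triangle)
  also have "\<dots> \<le> b" unfolding b
    using first chain passage_time_chain(1)[OF \<open>m \<le> K\<close>, of \<alpha> V N f w] passage_time_le_edge[of \<alpha> V N z "f m" w]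
    by (intro add_mono) (auto intro: order_trans)
  finally show "?T z (f K) \<le> b" .
  have "?T (f K) z \<le> ?T (f K) (f m) + ?T (f m) z" by (rule passage_time_triangle)
  also have "\<dots> \<le> ennreal (c powr \<alpha> / (1 - 2 powr - \<tau>)) + ennreal ((c * 2 ^ m) powr \<alpha> * s / v)"
    using first chain passage_time_chain(2)[OF \<open>m \<le> K\<close>, of \<alpha> V N f w] passage_time_le_edge[of \<alpha> V N "f m" z w]
    by (intro add_mono) (auto intro: order_trans simp: edge_time_commute[of _ _ _ _ "f m" z])
  finally show "?T (f K) z \<le> b" unfolding b by (simp add: add.commute)
qed

context ilrfpp
begin

text \<open>The summand in the summability hypothesis is the probability that a cube of side \<open>2\<^sup>k\<close> has no
  heavy vertex plus the probability that the noise on a given edge is too large at this scale.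
  Starting the chains at a scale \<open>m\<close> where the tail of the series is small, and treating the
  weights of \<open>0\<close> and \<open>u\<close> and the two edges at scale \<open>m\<close> by plain tightness, makes the total
  probability of failure at most \<open>\<epsilon>\<close>.\<close>

proposition passage_time_tight:
  assumes \<tau>: "\<alpha> + 2 * \<tau> = 2 * \<rho>" "0 < \<tau>" and V_pos: "AE v in \<nu>. 0 < v"
    and sum_q: "summable (\<lambda>k. (1 - measure \<nu> {(2 powr \<rho>) ^ k..}) ^ ((2 ^ k) ^ CARD('d)) + measure \<mu> {(2 powr \<tau>) ^ k<..})"
    and "0 < \<epsilon>"
  shows "\<exists>C. \<forall>u. 1 - \<epsilon> \<le> \<P>(w in M. passage_time \<alpha> V N 0 u w \<le> ennreal C)"
proof -
  interpret nu: prob_space \<nu> by (rule prob_space_nu)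
  interpret mu: prob_space \<mu> by (rule prob_space_mu)
  define q where "q k = (1 - measure \<nu> {(2 powr \<rho>) ^ k..}) ^ ((2 ^ k) ^ CARD('d)) + measure \<mu> {(2 powr \<tau>) ^ k<..}" for k
  have q_nonneg: "0 \<le> q k" for k
    unfolding q_def by (intro add_nonneg_nonneg zero_le_power) auto
  \<comment> \<open>Three failure events for each of the two chains, and one for the bridge between them.\<close>
  define \<delta> where "\<delta> = \<epsilon> / 7"
  have "0 < \<delta>" using \<open>0 < \<epsilon>\<close> by (simp add: \<delta>_def)
  obtain v where v: "0 < v" "measure \<nu> {..<v} \<le> \<delta>"
    using small_left_tail[OF nu.finite_measure_axioms sets_nu V_pos \<open>0 < \<delta>\<close>] by auto
  obtain s where s: "0 \<le> s" "measure \<mu> {s<..} \<le> \<delta>"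
    using small_right_tail[OF mu.finite_measure_axioms sets_mu \<open>0 < \<delta>\<close>] by auto
  have "summable q" using sum_q unfolding q_def .
  then obtain m where m: "\<And>n. (\<Sum>k\<in>{m..<n}. q k) \<le> \<delta>"
  proof -
    from \<open>summable q\<close> \<open>0 < \<delta>\<close> obtain m where "\<And>n. norm (\<Sum>k\<in>{m..<n}. q k) < \<delta>"
      unfolding summable_Cauchy by blast
    then have "(\<Sum>k\<in>{m..<n}. q k) \<le> \<delta>" for n
      using abs_le_D1[of "\<Sum>k\<in>{m..<n}. q k" \<delta>] by (simp add: less_imp_le)
    then show ?thesis by (rule that)
  qed
  define S where "S z k = first_above (cube z k) ((2 powr \<rho>) ^ k)" for z :: "int ^ 'd" and k
  define noisy where "noisy a b r = {w \<in> space M. a (\<lambda>x. V x w) \<noteq> b (\<lambda>x. V x w) \<and>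
      r < N {a (\<lambda>x. V x w), b (\<lambda>x. V x w)} w}" for a b and r :: real
  define sparse where "sparse z k = {w \<in> space M. \<forall>a\<in>cube z k. V a w < (2 powr \<rho>) ^ k}" for z k
  define low where "low z = V z -` {..<v} \<inter> space M" for z
  define bad where "bad z K = low z \<union> noisy (\<lambda>_. z) (S z m) s \<union>
      (\<Union>k\<in>{m..<Suc K}. sparse z k \<union> noisy (S z k) (S z (Suc k)) ((2 powr \<tau>) ^ k))" for z K
  have S_meas: "S z k \<in> measurable (PiM UNIV (\<lambda>_. borel)) (count_space UNIV)" for z k
    unfolding S_def by (rule measurable_first_above)
  have noisy: "noisy a b r \<in> events" "prob (noisy a b r) \<le> measure \<mu> {r<..}"
    if "a \<in> measurable (PiM UNIV (\<lambda>_. borel)) (count_space UNIV)"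
       "b \<in> measurable (PiM UNIV (\<lambda>_. borel)) (count_space UNIV)" for a b r
    unfolding noisy_def using that by (rule selected_noise)+
  have sparse: "sparse z k \<in> events"
    "prob (sparse z k) = (1 - measure \<nu> {(2 powr \<rho>) ^ k..}) ^ ((2 ^ k) ^ CARD('d))" for z k
  proof -
    have "cube z k \<noteq> {}" using base_in_cube[of z k] by blast
    note all_below = all_below[OF finite_cube this, of "(2 powr \<rho>) ^ k"]
    show "sparse z k \<in> events" unfolding sparse_def by (rule all_below(1))
    show "prob (sparse z k) = (1 - measure \<nu> {(2 powr \<rho>) ^ k..}) ^ ((2 ^ k) ^ CARD('d))"
      unfolding sparse_def card_cube[of z k, symmetric] by (rule all_below(2))
  qed
  have low: "low z \<in> events" "prob (low z) \<le> \<delta>" for z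
  proof -
    show "low z \<in> events" unfolding low_def by (rule measurable_sets[OF measurable_V]) simp
    have "prob (low z) = measure (distr M borel (V z)) {..<v}"
      unfolding low_def by (rule measure_distr[OF measurable_V, symmetric]) simp
    also have "\<dots> \<le> \<delta>" unfolding law_V by (rule v(2))
    finally show "prob (low z) \<le> \<delta>" .
  qed
  have const: "(\<lambda>_. z) \<in> measurable (PiM UNIV (\<lambda>_. borel)) (count_space UNIV)" for z :: "int ^ 'd"
    by simp
  have bad_events: "bad z K \<in> events" for z K
    unfolding bad_def by (intro sets.Un sets.finite_UN low sparse noisy S_meas const) auto
  have bad_prob: "prob (bad z K) \<le> 3 * \<delta>" for z K
  proof -
    let ?U = "\<lambda>k. sparse z k \<union> noisy (S z k) (S z (Suc k)) ((2 powr \<tau>) ^ k)"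
    have U: "?U k \<in> events" for k by (intro sets.Un sparse noisy S_meas)
    have Uq: "prob (?U k) \<le> q k" for k
      using measure_Un_le[OF sparse(1)[of z k] noisy(1)[OF S_meas S_meas, of z k z "Suc k" "(2 powr \<tau>) ^ k"]]
        sparse(2)[of z k] noisy(2)[OF S_meas S_meas, of z k z "Suc k" "(2 powr \<tau>) ^ k"]
      unfolding q_def by linarith
    have "prob (\<Union>k\<in>{m..<Suc K}. ?U k) \<le> (\<Sum>k\<in>{m..<Suc K}. prob (?U k))"
      using U by (intro measure_UNION_le) auto
    also have "\<dots> \<le> (\<Sum>k\<in>{m..<Suc K}. q k)" by (rule sum_mono) (rule Uq)
    also have "\<dots> \<le> \<delta>" by (rule m)
    finally have 1: "prob (\<Union>k\<in>{m..<Suc K}. ?U k) \<le> \<delta>" .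
    have 2: "prob (noisy (\<lambda>_. z) (S z m) s) \<le> \<delta>"
      using noisy(2)[OF const S_meas, of z z m s] s(2) by linarith
    have "prob (bad z K) \<le> prob (low z) + prob (noisy (\<lambda>_. z) (S z m) s) + prob (\<Union>k\<in>{m..<Suc K}. ?U k)"
      unfolding bad_def by (intro measure_Un3_le low noisy const S_meas sets.finite_UN U) simp
    with 1 2 low(2)[of z] show ?thesis by simp
  qed
  define c where "c = 2 * real CARD('d)"
  define b where "b = (c * 2 ^ m) powr \<alpha> * s / v + c powr \<alpha> / (1 - 2 powr - \<tau>)"
  have r1: "2 powr - \<tau> < 1" using \<tau> by (simp add: powr_less_one)
  have b: "0 \<le> b" unfolding b_def using v s r1 by (intro add_nonneg_nonneg) auto
  have c: "0 \<le> c" unfolding c_def by simp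
  have chain: "passage_time \<alpha> V N z (S z K (\<lambda>x. V x w)) w \<le> ennreal b"
      "passage_time \<alpha> V N (S z K (\<lambda>x. V x w)) z w \<le> ennreal b"
    and site: "S z K (\<lambda>x. V x w) \<in> cube z K" "(2 powr \<rho>) ^ K \<le> V (S z K (\<lambda>x. V x w)) w"
    if w: "w \<in> space M" "w \<notin> bad z K" and "m \<le> K" for w z K
  proof -
    let ?f = "\<lambda>k. S z k (\<lambda>x. V x w)"
    have sites: "?f k \<in> cube z k \<and> (2 powr \<rho>) ^ k \<le> V (?f k) w" if "k \<in> {m..K}" for k
    proof -
      from that w have "w \<notin> sparse z k" unfolding bad_def by auto
      with w obtain a where "a \<in> cube z k" "(2 powr \<rho>) ^ k \<le> V a w"
        unfolding sparse_def by (auto simp: not_less)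
      then show ?thesis using first_above[of a "cube z k" "(2 powr \<rho>) ^ k" "\<lambda>x. V x w"]
        unfolding S_def by simp
    qed
    have "v \<le> V z w" using w unfolding bad_def low_def by auto
    moreover have "N {z, ?f m} w \<le> s" if "z \<noteq> ?f m"
      using w that unfolding bad_def noisy_def by auto
    moreover have "N {?f k, ?f (Suc k)} w \<le> (2 powr \<tau>) ^ k" if "k \<in> {m..<K}" "?f k \<noteq> ?f (Suc k)" for k
    proof -
      have "w \<notin> noisy (S z k) (S z (Suc k)) ((2 powr \<tau>) ^ k)" using that w unfolding bad_def by auto
      then show ?thesis using that w unfolding noisy_def by auto
    qed
    ultimately show "passage_time \<alpha> V N z (?f K) w \<le> ennreal b" "passage_time \<alpha> V N (?f K) z w \<le> ennreal b"
      unfolding b_def c_def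
      using chain_cost[OF alpha_pos \<tau> \<open>m \<le> K\<close> v(1) s(1), of V z w ?f N] sites by blast+
    show "?f K \<in> cube z K" "(2 powr \<rho>) ^ K \<le> V (?f K) w" using sites[of K] \<open>m \<le> K\<close> by auto
  qed
  define C where "C = b + c powr \<alpha> + b"
  have "1 - \<epsilon> \<le> \<P>(w in M. passage_time \<alpha> V N 0 u w \<le> ennreal C)" for u
  proof -
    \<comment> \<open>At scale \<open>K\<close> the base points \<open>0\<close> and \<open>u\<close> are no farther apart than the side of their cubes.\<close>
    obtain j where "l1_norm (0 - u) < 2 ^ j" using real_arch_pow[of 2 "l1_norm (0 - u)"] by auto
    moreover define K where "K = max j m"
    ultimately have K: "m \<le> K" "l1_norm (0 - u) \<le> 2 ^ K"
      using power_increasing[of j K "2 :: real"] by (auto intro: order_trans less_imp_le)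
    define bridge where "bridge = noisy (S 0 K) (S u K) ((2 powr \<tau>) ^ K)"
    have bridge: "bridge \<in> events" unfolding bridge_def by (intro noisy S_meas)
    have "prob bridge \<le> q K"
      using noisy(2)[OF S_meas S_meas, of 0 K u K "(2 powr \<tau>) ^ K"] unfolding bridge_def q_def
      by (smt (verit) nu.prob_le_1 zero_le_power)
    also have "\<dots> \<le> \<delta>"
      using m[of "Suc K"] K(1) sum_nonneg[of "{m..<K}" q] q_nonneg by simp
    finally have bridge_prob: "prob bridge \<le> \<delta>" .
    let ?B = "bad 0 K \<union> bad u K \<union> bridge"
    let ?G = "{w \<in> space M. passage_time \<alpha> V N 0 u w \<le> ennreal C}"
    have "prob ?B \<le> prob (bad 0 K) + prob (bad u K) + prob bridge"
      by (intro measure_Un3_le bad_events bridge)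
    also have "\<dots> \<le> \<epsilon>" using bad_prob[of 0 K] bad_prob[of u K] bridge_prob unfolding \<delta>_def by simp
    finally have "1 - \<epsilon> \<le> prob (space M - ?B)"
      using prob_compl[of ?B] bad_events bridge by auto
    also have "\<dots> \<le> prob ?G"
    proof (rule finite_measure_mono)
      have [measurable]: "passage_time \<alpha> V N 0 u \<in> borel_measurable M" by (rule measurable_passage_time)
      show "?G \<in> events" by measurable
      show "space M - ?B \<subseteq> ?G"
      proof
        fix w assume "w \<in> space M - ?B"
        then have w: "w \<in> space M" "w \<notin> bad 0 K" "w \<notin> bad u K" "w \<notin> bridge" by auto
        let ?T = "\<lambda>x y. passage_time \<alpha> V N x y w"
        let ?x = "S 0 K (\<lambda>x. V x w)" and ?y = "S u K (\<lambda>x. V x w)"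
        have "?T ?x ?y \<le> edge_time \<alpha> V N w ?x ?y" by (rule passage_time_le_edge)
        also have "\<dots> \<le> ennreal ((c * 2 ^ K) powr \<alpha> * (2 powr \<tau>) ^ K / ((2 powr \<rho>) ^ K * (2 powr \<rho>) ^ K))"
          using w K site[of w 0 K] site[of w u K] alpha_pos
          by (intro edge_time_le) (auto simp: c_def bridge_def noisy_def intro!: l1_norm_cross_cube)
        also have "\<dots> = ennreal (c powr \<alpha> * (2 powr - \<tau>) ^ K)"
          by (simp only: scale_cost[OF \<tau>(1) c])
        also have "\<dots> \<le> ennreal (c powr \<alpha>)"
          using r1 by (intro ennreal_leI mult_left_le power_le_one) auto
        finally have xy: "?T ?x ?y \<le> ennreal (c powr \<alpha>)" .
        have "?T 0 u \<le> ?T 0 ?x + ?T ?x u" by (rule passage_time_triangle)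
        also have "?T ?x u \<le> ?T ?x ?y + ?T ?y u" by (rule passage_time_triangle)
        finally have "?T 0 u \<le> ?T 0 ?x + (?T ?x ?y + ?T ?y u)" by (simp add: add_left_mono)
        also have "\<dots> \<le> ennreal b + (ennreal (c powr \<alpha>) + ennreal b)"
          using chain(1)[of w 0 K] chain(2)[of w u K] xy w K by (intro add_mono) auto
        also have "\<dots> = ennreal C" unfolding C_def using b by (simp add: ennreal_plus[symmetric] add.assoc del: ennreal_plus)
        finally show "w \<in> ?G" using w by simp
      qed
    qed
    finally show ?thesis .
  qed
  then show ?thesis by blast
qed

end

section \<open>Asymptotics of the passage time\<close>

text \<open>A nonzero coordinate of \<open>n x\<close> eventually exceeds \<open>1\<close> in absolute value; a small negative one
  would be rounded up to \<open>0\<close>.\<close>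

lemma ceiling_vec_nonzero:
  fixes x :: "real ^ 'd::finite"
  assumes "x \<noteq> 0"
  shows "\<forall>\<^sub>F n in sequentially. ceiling_vec (real n *\<^sub>R x) \<noteq> 0"
proof -
  obtain i where i: "x $ i \<noteq> 0" using assms by (auto simp: vec_eq_iff)
  have "\<forall>\<^sub>F n in sequentially. 1 / \<bar>x $ i\<bar> < real n"
    using filterlim_real_sequentially by (auto simp: filterlim_at_top_dense)
  then show ?thesis
  proof eventually_elim
    case (elim n)
    then have "1 < \<bar>real n * x $ i\<bar>" using i by (simp add: abs_mult field_simps)
    then have "\<lceil>real n * x $ i\<rceil> \<noteq> 0" by (auto simp: ceiling_eq_iff abs_if split: if_splits)
    then show ?case by (auto simp: ceiling_vec_def vec_eq_iff)
  qed
qed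

theorem theorem2p6:
  fixes M :: "'a measure"
    and \<alpha> \<gamma> \<theta> \<zeta> :: real
    and \<nu> \<mu> :: "real measure"
    and V :: "int ^ 'd::finite \<Rightarrow> 'a \<Rightarrow> real"
    and N :: "(int ^ 'd) set \<Rightarrow> 'a \<Rightarrow> real"
  assumes model: "ilrfpp M \<alpha> \<nu> \<mu> V N"
    and standing: "standing_assumptions \<nu> \<mu> \<gamma> \<theta> \<zeta>"
    and alpha: "\<alpha> > max (real CARD('d) / \<theta>) (real CARD('d) / \<gamma>)"
  shows "(\<exists>\<eta> C :: real. \<eta> > 0 \<and>
           (\<forall>t\<in>{0..1}.
              (SUP u\<in>UNIV - {0 :: int ^ 'd}. \<P>(w in M. passage_time \<alpha> V N 0 u w \<le> ennreal t))
                \<le> C * t powr \<eta>))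
       \<and> (\<forall>x :: real ^ 'd. infnorm x \<le> 1 \<and> x \<noteq> 0 \<longrightarrow>
            Omega_P1 M (\<lambda>n. passage_time \<alpha> V N 0 (ceiling_vec (real n *\<^sub>R x)))
          \<and> (\<alpha> < 2 * real CARD('d) / \<gamma> \<longrightarrow>
              Theta_P1 M (\<lambda>n. passage_time \<alpha> V N 0 (ceiling_vec (real n *\<^sub>R x)))))"
proof -
  interpret ilrfpp M \<alpha> \<nu> \<mu> V N by (rule model)
  interpret nu: prob_space \<nu> by (rule prob_space_nu)
  interpret mu: prob_space \<mu> by (rule prob_space_mu)
  let ?d = "real CARD('d)" and ?T = "passage_time \<alpha> V N 0"
  have space: "space \<nu> = UNIV" "space \<mu> = UNIV"
    using sets_eq_imp_space_eq[OF sets_nu] sets_eq_imp_space_eq[OF sets_mu] by auto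
  from standing have pos: "0 < \<gamma>" "0 < \<theta>" "0 < \<zeta>" and V_pos: "AE v in \<nu>. 0 < v"
    and V_tail: "((\<lambda>x. ln (measure \<nu> {x..}) / ln x) \<longlongrightarrow> - \<gamma>) at_top"
    and N_tail: "((\<lambda>x. ln (measure \<mu> {..x}) / ln x) \<longlongrightarrow> \<theta>) (at_right 0)"
    and N_int: "integrable \<mu> (\<lambda>r. r powr \<zeta>)"
    unfolding standing_assumptions_def by auto
  have d: "0 < ?d" by simp
  have N_tail': "((\<lambda>x. ln (measure \<mu> {..inverse x}) / ln x) \<longlongrightarrow> - \<theta>) at_top"
    by (rule log_tail_inverse[OF N_tail])
  \<comment> \<open>Two exponents are needed: tails decay with exponent \<open>\<kappa>'\<close>, which yields moments of the smaller order \<open>\<kappa>\<close>.\<close>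
  have "?d / \<alpha> < min \<theta> \<gamma>"
    using alpha pos alpha_pos by (auto simp: field_simps)
  then obtain \<kappa>' where "?d / \<alpha> < \<kappa>'" and \<kappa>': "\<kappa>' < min \<theta> \<gamma>" using dense by blast
  from dense[OF this(1)] obtain \<kappa> where \<kappa>: "?d / \<alpha> < \<kappa>" "\<kappa> < \<kappa>'" by blast
  have "0 < ?d / \<alpha>" using alpha_pos by simp
  with \<kappa> have \<kappa>0: "0 < \<kappa>" by linarith
  have dim: "?d < \<alpha> * \<kappa>" using \<kappa> alpha_pos by (simp add: field_simps)
  have N_small: "\<forall>\<^sub>F x in at_top. measure \<mu> {..inverse x} \<le> x powr - \<kappa>'"
    using \<kappa>' by (intro log_tail_upper[OF N_tail']) auto
  have N_pos: "AE r in \<mu>. 0 < r"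
  proof -
    have "((\<lambda>x::real. x powr - \<kappa>') \<longlongrightarrow> 0) at_top"
      using \<kappa> \<kappa>0 by (intro tendsto_neg_powr filterlim_ident) auto
    moreover have "\<forall>\<^sub>F x in at_top. measure \<mu> {..0} \<le> x powr - \<kappa>'"
      using N_small eventually_gt_at_top[of 0]
    proof eventually_elim
      case (elim x)
      then have "measure \<mu> {..0} \<le> measure \<mu> {..inverse x}"
        by (intro mu.finite_measure_mono) auto
      with elim show ?case by linarith
    qed
    ultimately have "measure \<mu> {..0} \<le> 0"
      by (rule tendsto_lowerbound) simp
    then have "{..0} \<in> null_sets \<mu>"
      by (auto simp: null_sets_def mu.emeasure_eq_measure measure_le_0_iff)
    then show ?thesis by (rule AE_I') (auto simp: not_less)
  qed
  have "(\<integral>\<^sup>+v. ennreal (v powr \<kappa>) \<partial>\<nu>) < \<infinity>"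
  proof (rule nu.moment_finite_of_tail[OF _ V_pos _ \<kappa>0 \<kappa>(2)])
    show "\<forall>\<^sub>F x in at_top. measure \<nu> {w \<in> space \<nu>. x \<le> w} \<le> x powr - \<kappa>'"
      using log_tail_upper[OF V_tail] \<kappa>' by (simp add: space atLeast_def)
  qed simp
  moreover have "(\<integral>\<^sup>+r. ennreal (r powr - \<kappa>) \<partial>\<mu>) < \<infinity>"
  proof -
    have "(\<integral>\<^sup>+r. ennreal (inverse r powr \<kappa>) \<partial>\<mu>) < \<infinity>"
    proof (rule mu.moment_finite_of_tail[OF _ _ _ \<kappa>0 \<kappa>(2)])
      show "AE r in \<mu>. 0 < inverse r" using N_pos by simp
      show "\<forall>\<^sub>F x in at_top. measure \<mu> {w \<in> space \<mu>. x \<le> inverse w} \<le> x powr - \<kappa>'"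
        using N_small eventually_gt_at_top[of 0]
      proof eventually_elim
        case (elim x)
        have "{w \<in> space \<mu>. x \<le> inverse w} \<subseteq> {..inverse x}"
          using elim by (auto intro: inverse_le_imp_le le_imp_inverse_le simp: inverse_eq_divide field_simps split: if_splits)
        then have "measure \<mu> {w \<in> space \<mu>. x \<le> inverse w} \<le> measure \<mu> {..inverse x}"
          by (intro mu.finite_measure_mono) auto
        with elim show ?case by linarith
      qed
    qed simp
    also have "(\<integral>\<^sup>+r. ennreal (inverse r powr \<kappa>) \<partial>\<mu>) = (\<integral>\<^sup>+r. ennreal (r powr - \<kappa>) \<partial>\<mu>)"
      using N_pos by (intro nn_integral_cong_AE, eventually_elim) (simp add: powr_minus inverse_powr)
    finally show ?thesis .
  qed
  ultimately obtain C where C: "0 \<le> C"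
      "\<And>u t. u \<noteq> 0 \<Longrightarrow> 0 \<le> t \<Longrightarrow> \<P>(w in M. ?T u w \<le> ennreal t) \<le> C * t powr \<kappa>"
    using passage_time_small_prob[OF \<kappa>0 dim V_pos N_pos] by blast
  have nonempty: "UNIV - {0 :: int ^ 'd} \<noteq> {}"
    using ex_edge by (auto simp: edge_iff)
  have sup: "\<exists>\<eta> C :: real. \<eta> > 0 \<and> (\<forall>t\<in>{0..1}.
      (SUP u\<in>UNIV - {0 :: int ^ 'd}. \<P>(w in M. ?T u w \<le> ennreal t)) \<le> C * t powr \<eta>)"
    using \<kappa>0 C nonempty by (intro exI[of _ \<kappa>] exI[of _ C] conjI ballI cSUP_least) auto
  have Omega: "Omega_P1 M (\<lambda>n. ?T (ceiling_vec (real n *\<^sub>R x)))" if "x \<noteq> 0" for x :: "real ^ 'd"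
    unfolding Omega_P1_def
  proof (intro allI impI)
    fix \<epsilon> :: real assume "0 < \<epsilon>"
    \<comment> \<open>The summand \<open>1\<close> covers the case \<open>C = 0\<close>.\<close>
    define c where "c = (\<epsilon> / (C + 1)) powr (1 / \<kappa>)"
    have c: "0 < c" using \<open>0 < \<epsilon>\<close> \<open>0 \<le> C\<close> by (simp add: c_def)
    have "C * c powr \<kappa> = C * (\<epsilon> / (C + 1))"
      using \<open>0 < \<epsilon>\<close> \<open>0 \<le> C\<close> \<kappa>0 by (simp add: c_def powr_powr)
    also have "\<dots> \<le> \<epsilon>" using \<open>0 < \<epsilon>\<close> \<open>0 \<le> C\<close> by (simp add: field_simps)
    finally have small: "C * c powr \<kappa> \<le> \<epsilon>" .
    have "\<forall>\<^sub>F n in sequentially. 1 - \<epsilon> \<le> \<P>(w in M. ennreal c \<le> ?T (ceiling_vec (real n *\<^sub>R x)) w)"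
      using ceiling_vec_nonzero[OF that]
    proof eventually_elim
      case (elim n)
      let ?u = "ceiling_vec (real n *\<^sub>R x)"
      have [measurable]: "?T ?u \<in> borel_measurable M" by (rule measurable_passage_time)
      have "1 - \<epsilon> \<le> 1 - \<P>(w in M. ?T ?u w \<le> ennreal c)"
        using C(2)[OF elim, of c] c small by simp
      also have "\<dots> = \<P>(w in M. \<not> ?T ?u w \<le> ennreal c)"
        by (rule prob_neg[symmetric]) measurable
      also have "\<dots> \<le> \<P>(w in M. ennreal c \<le> ?T ?u w)"
        by (intro finite_measure_mono) auto
      finally show ?case .
    qed
    with c show "\<exists>c>0. \<forall>\<^sub>F n in sequentially. 1 - \<epsilon> \<le> \<P>(w in M. ennreal c \<le> ?T (ceiling_vec (real n *\<^sub>R x)) w)"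
      by blast
  qed
  have O: "O_P1 M (\<lambda>n. ?T (ceiling_vec (real n *\<^sub>R x)))" if less: "\<alpha> < 2 * ?d / \<gamma>" for x :: "real ^ 'd"
  proof -
    from less have "\<alpha> / 2 < ?d / \<gamma>" by (simp add: mult.commute)
    then obtain \<rho> where \<rho>: "\<alpha> / 2 < \<rho>" "\<rho> < ?d / \<gamma>" using dense by blast
    have \<rho>0: "0 < \<rho>" using \<rho> alpha_pos by linarith
    define \<tau> where "\<tau> = \<rho> - \<alpha> / 2"
    have \<tau>: "\<alpha> + 2 * \<tau> = 2 * \<rho>" "0 < \<tau>" using \<rho> by (auto simp: \<tau>_def)
    \<comment> \<open>Room for a tail exponent slightly above \<open>\<gamma>\<close> with \<open>\<rho>\<gamma>' < d\<close>.\<close>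
    have "\<gamma> < ?d / \<rho>" using \<rho> \<rho>0 pos by (simp add: field_simps)
    then obtain \<gamma>' where \<gamma>': "\<gamma> < \<gamma>'" "\<gamma>' < ?d / \<rho>" using dense by blast
    have "\<forall>\<^sub>F x in at_top. x powr - \<gamma>' \<le> measure \<nu> {x..}"
      using pos \<gamma>' by (intro log_tail_lower[OF V_tail]) auto
    moreover have "filterlim (\<lambda>k. (2 powr \<rho>) ^ k) at_top sequentially"
      using \<rho>0 by (intro filterlim_real_power_at_top) simp
    ultimately have "\<forall>\<^sub>F k in sequentially. ((2 powr \<rho>) ^ k) powr - \<gamma>' \<le> measure \<nu> {(2 powr \<rho>) ^ k..}"
      by (rule eventually_compose_filterlim)
    moreover have "((2 powr \<rho>) ^ k) powr - \<gamma>' = (2 powr - (\<rho> * \<gamma>')) ^ k" for k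
      by (simp add: powr_powr powr_realpow[symmetric] mult_ac)
    ultimately have "summable (\<lambda>k. (1 - measure \<nu> {(2 powr \<rho>) ^ k..}) ^ ((2 ^ k) ^ CARD('d)))"
      using \<gamma>' \<rho>0 by (intro sparse_summable[of _ "\<rho> * \<gamma>'"]) (auto simp: field_simps)
    moreover have "summable (\<lambda>k. measure \<mu> {(2 powr \<tau>) ^ k<..})"
    proof (rule summable_comparison_test')
      show "summable (\<lambda>k. (\<integral>r. r powr \<zeta> \<partial>\<mu>) * (2 powr - (\<tau> * \<zeta>)) ^ k)"
        using \<tau> pos by (intro summable_mult summable_geometric) (simp add: powr_less_one)
      fix k :: nat
      have "measure \<mu> {(2 powr \<tau>) ^ k<..} \<le> (\<integral>r. r powr \<zeta> \<partial>\<mu>) * ((2 powr \<tau>) ^ k) powr - \<zeta>"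
        using mu.polynomial_noise_tail[OF _ N_int, of "(2 powr \<tau>) ^ k"] pos
        by (simp add: space greaterThan_def)
      also have "((2 powr \<tau>) ^ k) powr - \<zeta> = (2 powr - (\<tau> * \<zeta>)) ^ k"
        by (simp add: powr_powr powr_realpow[symmetric] mult_ac)
      finally show "norm (measure \<mu> {(2 powr \<tau>) ^ k<..}) \<le> (\<integral>r. r powr \<zeta> \<partial>\<mu>) * (2 powr - (\<tau> * \<zeta>)) ^ k"
        by simp
    qed
    ultimately have "\<exists>C. \<forall>u. 1 - \<epsilon> \<le> \<P>(w in M. ?T u w \<le> ennreal C)" if "0 < \<epsilon>" for \<epsilon>
      by (intro passage_time_tight[OF \<tau> V_pos _ that] summable_add)
    then show ?thesis unfolding O_P1_def by (meson always_eventually)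
  qed
  from sup Omega O show ?thesis unfolding Theta_P1_def by blast
qed

end
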